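(* Let $X$ be a first countable realcompact Tychonoff space which is not pseudocompact. Then there exists a family, of cardinality at least $2^{\mathfrak{c}}$, of $C$-type intermediate rings lying between $C^*(X)$ and $C(X)$, no two distinct members of which are isomorphic as rings.
   Context: For a Tychonoff space $X$, $C(X)$ is the ring of all real-valued continuous functions on $X$ and $C^*(X)$ is its subring of bounded functions; $X$ is pseudocompact if $C^*(X)=C(X)$. An intermediate ring is a subring $A(X)$ of $C(X)$ with $C^*(X)\subseteq A(X)\subseteq C(X)$. An intermediate ring is of $C$-type (a $C$-type ring) if it is isomorphic as a ring to $C(Y)$ for some Tychonoff space $Y$. The space $X$ is realcompact if $\upsilon X=X$, where $\upsilon X$ is the Hewitt realcompactification: $\upsilon X=\{p\in\beta X: f^*(p)\in\mathbb{R}\text{ for each }f\in C(X)\}$, with $f^*:\beta X\to\mathbb{R}\cup\{\infty\}$ (one-point compactification of $\mathbb{R}$) the unique continuous extension of $f$ to the Stone-Čech compactification $\beta X$. Here $\mathfrak{c}=2^{\aleph_0}$. *)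

theory Defs
  imports "HOL-Analysis.Analysis" "HOL-Algebra.QuotRing" "HOL-Algebra.Subrings"
begin

no_notation eq_closure_of (\<open>closure'_of\<index>\<close>)  (* clashes with the topological closure_of *)

definition Tychonoff_space :: "'a topology \<Rightarrow> bool" where
  "Tychonoff_space X \<longleftrightarrow> completely_regular_space X \<and> Hausdorff_space X"

section \<open>The ring \<open>C(X)\<close> and its intermediate rings\<close>

text \<open>Functions are kept extensional on \<^term>\<open>topspace X\<close>, so that HOL equality of elements of
  the ring is equality of functions on the space.\<close>

definition C_ring :: "'a topology \<Rightarrow> ('a \<Rightarrow> real) ring" where
  "C_ring X =
    \<lparr>carrier = {f \<in> extensional (topspace X). continuous_map X euclideanreal f},
     monoid.mult = (\<lambda>f g. \<lambda>x\<in>topspace X. f x * g x),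
     one = (\<lambda>x\<in>topspace X. 1),
     zero = (\<lambda>x\<in>topspace X. 0),
     add = (\<lambda>f g. \<lambda>x\<in>topspace X. f x + g x)\<rparr>"

definition C_bdd :: "'a topology \<Rightarrow> ('a \<Rightarrow> real) set" where
  "C_bdd X = {f \<in> carrier (C_ring X). bounded (f ` topspace X)}"

definition pseudocompact_space :: "'a topology \<Rightarrow> bool" where
  "pseudocompact_space X \<longleftrightarrow> C_bdd X = carrier (C_ring X)"

abbreviation subring_of_C :: "'a topology \<Rightarrow> ('a \<Rightarrow> real) set \<Rightarrow> ('a \<Rightarrow> real) ring" where
  "subring_of_C X A \<equiv> (C_ring X)\<lparr>carrier := A\<rparr>"

definition intermediate_ring :: "'a topology \<Rightarrow> ('a \<Rightarrow> real) set \<Rightarrow> bool" where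
  "intermediate_ring X A \<longleftrightarrow> subring A (C_ring X) \<and> C_bdd X \<subseteq> A"

text \<open>HOL cannot quantify over the type of the points of \<open>Y\<close> inside a definition.  The type chosen
  below is large enough to be no restriction: if \<open>A\<close> is isomorphic to \<open>C(Y)\<close>, then
  \<open>Y\<close> embeds into the functions \<open>A \<Rightarrow> \<real>\<close> by evaluation.  See lemma \<open>C_typeI\<close>,
  where \<open>Y\<close> lives over an arbitrary type.\<close>

definition C_type :: "'a topology \<Rightarrow> ('a \<Rightarrow> real) set \<Rightarrow> bool" where
  "C_type X A \<longleftrightarrow>
     (\<exists>Y :: (('a \<Rightarrow> real) \<Rightarrow> real) topology. Tychonoff_space Y \<and> subring_of_C X A \<simeq> C_ring Y)"

definition unit_maps :: "'a topology \<Rightarrow> ('a \<Rightarrow> real) set" where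
  "unit_maps X = {f \<in> extensional (topspace X). continuous_map X (top_of_set {0..1}) f}"

lemma unit_maps_subset: "unit_maps X \<subseteq> carrier (C_ring X)"
  by (auto simp: unit_maps_def C_ring_def continuous_map_in_subtopology)

lemma Tychonoff_space_homeomorphic:
  assumes "Tychonoff_space Y" "Y homeomorphic_space Z"
  shows "Tychonoff_space Z"
  using assms homeomorphic_completely_regular_space[of Y Z] homeomorphic_Hausdorff_space[of Y Z]
  unfolding Tychonoff_space_def by simp

lemma Tychonoff_separates:
  assumes "Tychonoff_space Y" "x \<in> topspace Y" "y \<in> topspace Y" "x \<noteq> y"
  shows "\<exists>f \<in> unit_maps Y. f x \<noteq> f y"
proof -
  have "t1_space Y"
    using assms(1) Hausdorff_imp_t1_space unfolding Tychonoff_space_def by blast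
  then have "closedin Y {y}"
    using assms(3) by (simp add: closedin_t1_singleton)
  moreover have "x \<in> topspace Y - {y}"
    using assms by simp
  ultimately have "\<exists>f. continuous_map Y (top_of_set {0..1::real}) f \<and> f x = 0 \<and> f ` {y} \<subseteq> {1}"
    using assms(1) unfolding Tychonoff_space_def completely_regular_space_def image_subset_iff_funcset
    by blast
  then obtain f where f: "continuous_map Y (top_of_set {0..1::real}) f" "f x = 0" "f y = 1"
    by auto
  let ?f = "restrict f (topspace Y)"
  have "continuous_map Y (top_of_set {0..1}) ?f"
    using f(1) by (rule continuous_map_eq) auto
  then have "?f \<in> unit_maps Y"
    by (simp add: unit_maps_def)
  moreover have "?f x \<noteq> ?f y"
    using f assms by simp
  ultimately show ?thesis by blast
qed

lemma C_ring_homeomorphic_map: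
  assumes "homeomorphic_map Y Z e"
  shows "C_ring Y \<simeq> C_ring Z"
proof -
  obtain d where d: "homeomorphic_maps Y Z e d"
    using assms homeomorphic_map_maps by blast
  then have ed: "continuous_map Y Z e" "continuous_map Z Y d"
      "\<And>y. y \<in> topspace Y \<Longrightarrow> d (e y) = y" "\<And>z. z \<in> topspace Z \<Longrightarrow> e (d z) = z"
    by (auto simp: homeomorphic_maps_def)
  have in_top: "\<And>y. y \<in> topspace Y \<Longrightarrow> e y \<in> topspace Z" "\<And>z. z \<in> topspace Z \<Longrightarrow> d z \<in> topspace Y"
    using ed(1,2) continuous_map_image_subset_topspace by blast+
  define \<phi> where "\<phi> = (\<lambda>f::'a \<Rightarrow> real. restrict (f \<circ> d) (topspace Z))"
  define \<psi> where "\<psi> = (\<lambda>f::'b \<Rightarrow> real. restrict (f \<circ> e) (topspace Y))"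
  have \<phi>: "\<phi> f \<in> carrier (C_ring Z)" if "f \<in> carrier (C_ring Y)" for f
    using that ed continuous_map_compose[of Z Y d euclideanreal f] unfolding \<phi>_def C_ring_def
    by (auto intro: continuous_map_eq)
  have \<psi>: "\<psi> f \<in> carrier (C_ring Y)" if "f \<in> carrier (C_ring Z)" for f
    using that ed continuous_map_compose[of Y Z e euclideanreal f] unfolding \<psi>_def C_ring_def
    by (auto intro: continuous_map_eq)
  have "bij_betw \<phi> (carrier (C_ring Y)) (carrier (C_ring Z))"
  proof (rule bij_betw_byWitness[where f' = \<psi>])
    show "\<forall>f\<in>carrier (C_ring Y). \<psi> (\<phi> f) = f"
      unfolding \<phi>_def \<psi>_def C_ring_def using ed in_top
      by (auto simp: restrict_def fun_eq_iff extensional_def)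
    show "\<forall>f\<in>carrier (C_ring Z). \<phi> (\<psi> f) = f"
      unfolding \<phi>_def \<psi>_def C_ring_def using ed in_top
      by (auto simp: restrict_def fun_eq_iff extensional_def)
  qed (use \<phi> \<psi> in auto)
  moreover have "\<phi> \<in> ring_hom (C_ring Y) (C_ring Z)"
  proof (rule ring_hom_memI)
  qed (use \<phi> in_top in \<open>auto simp: \<phi>_def C_ring_def restrict_def fun_eq_iff\<close>)
  ultimately show ?thesis
    unfolding is_ring_iso_def ring_iso_def by blast
qed

lemma C_typeI:
  fixes X :: "'a topology" and Y :: "'b topology"
  assumes "Tychonoff_space Y" and iso: "subring_of_C X A \<simeq> C_ring Y"
  shows "C_type X A"
proof -
  obtain h where h: "h \<in> ring_iso (subring_of_C X A) (C_ring Y)"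
    using iso unfolding is_ring_iso_def by blast
  then have him: "h ` A = carrier (C_ring Y)"
    unfolding ring_iso_def bij_betw_def by auto
  define e where "e = (\<lambda>y f. if f \<in> A then h f y else 0)"
  have inj: "inj_on e (topspace Y)"
  proof (rule inj_onI, rule ccontr)
    fix x y assume xy: "x \<in> topspace Y" "y \<in> topspace Y" "e x = e y" "x \<noteq> y"
    then obtain g where "g \<in> unit_maps Y" "g x \<noteq> g y"
      using Tychonoff_separates[OF assms(1) xy(1,2,4)] by blast
    then have "g \<in> h ` A" "g x \<noteq> g y"
      using unit_maps_subset[of Y] him by auto
    then obtain f where "f \<in> A" "h f x \<noteq> h f y"
      by blast
    then show False
      using fun_cong[OF xy(3), of f] by (simp add: e_def)
  qed
  define d where "d = inv_into (topspace Y) e"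
  define Z where "Z = pullback_topology (e ` topspace Y) d Y"
  have de: "d (e y) = y" if "y \<in> topspace Y" for y
    using inj that by (simp add: d_def)
  have topZ: "topspace Z = e ` topspace Y"
    unfolding Z_def topspace_pullback_topology using de by auto
  have "continuous_map Z Y d"
    unfolding Z_def using continuous_map_pullback[of Y Y id] by auto
  moreover have "continuous_map Y Z e"
    unfolding Z_def
  proof (rule continuous_map_pullback')
    show "continuous_map Y Y (d \<circ> e)"
      by (rule continuous_map_eq[of _ _ id]) (auto simp: de)
  qed auto
  ultimately have "homeomorphic_maps Y Z e d"
    unfolding homeomorphic_maps_def using de topZ by auto
  then have e: "homeomorphic_map Y Z e"
    using homeomorphic_maps_map by blast
  have "Tychonoff_space Z"
    using Tychonoff_space_homeomorphic assms(1) e homeomorphic_space by blast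
  moreover have "subring_of_C X A \<simeq> C_ring Z"
    using iso C_ring_homeomorphic_map[OF e] ring_iso_trans by blast
  ultimately show ?thesis
    unfolding C_type_def by blast
qed

section \<open>The Stone-Cech compactification and realcompactness\<close>

definition beta_emb :: "'a topology \<Rightarrow> 'a \<Rightarrow> ('a \<Rightarrow> real) \<Rightarrow> real" where
  "beta_emb X x = (\<lambda>f\<in>unit_maps X. f x)"

definition beta_cube :: "'a topology \<Rightarrow> (('a \<Rightarrow> real) \<Rightarrow> real) topology" where
  "beta_cube X = product_topology (\<lambda>f. top_of_set {0..1}) (unit_maps X)"

definition beta :: "'a topology \<Rightarrow> (('a \<Rightarrow> real) \<Rightarrow> real) topology" where
  "beta X = subtopology (beta_cube X) (beta_cube X closure_of (beta_emb X ` topspace X))"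

text \<open>The extension \<open>f\<^sup>*\<close> of \<open>f\<close> to \<open>\<beta>X\<close>, with values in the one-point
  compactification of the reals, whose point at infinity is \<^const>\<open>None\<close>.\<close>

definition is_beta_ext ::
    "'a topology \<Rightarrow> ('a \<Rightarrow> real) \<Rightarrow> ((('a \<Rightarrow> real) \<Rightarrow> real) \<Rightarrow> real option) \<Rightarrow> bool" where
  "is_beta_ext X f g \<longleftrightarrow>
     g \<in> extensional (topspace (beta X)) \<and>
     continuous_map (beta X) (Alexandroff_compactification euclideanreal) g \<and>
     (\<forall>x\<in>topspace X. g (beta_emb X x) = Some (f x))"

definition beta_ext :: "'a topology \<Rightarrow> ('a \<Rightarrow> real) \<Rightarrow> (('a \<Rightarrow> real) \<Rightarrow> real) \<Rightarrow> real option" where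
  "beta_ext X f = (THE g. is_beta_ext X f g)"

lemma beta_emb_continuous: "continuous_map X (beta_cube X) (beta_emb X)"
  unfolding beta_cube_def continuous_map_componentwise
proof (intro conjI ballI)
  fix f assume "f \<in> unit_maps X"
  then show "continuous_map X (top_of_set {0..1}) (\<lambda>x. beta_emb X x f)"
    by (simp add: beta_emb_def unit_maps_def)
qed (auto simp: beta_emb_def)

lemma Hausdorff_beta_cube: "Hausdorff_space (beta_cube X)"
  unfolding beta_cube_def
  by (simp add: Hausdorff_space_product_topology Hausdorff_space_subtopology)

lemma beta_emb_image_closure:
  "beta_emb X ` topspace X \<subseteq> beta_cube X closure_of (beta_emb X ` topspace X)"
  by (rule closure_of_subset) (rule continuous_map_image_subset_topspace[OF beta_emb_continuous])

lemma beta_emb_in_beta: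
  assumes "x \<in> topspace X"
  shows "beta_emb X x \<in> topspace (beta X)"
proof -
  have "beta_emb X x \<in> beta_cube X closure_of (beta_emb X ` topspace X)"
    using beta_emb_image_closure[of X] assms by auto
  then show ?thesis
    unfolding beta_def topspace_subtopology by (simp add: in_closure_of)
qed

lemma beta_dense: "beta X closure_of (beta_emb X ` topspace X) = topspace (beta X)"
  unfolding beta_def using beta_emb_image_closure[of X]
  by (simp add: closure_of_subtopology Int_absorb1 closure_of_subset_topspace)

text \<open>Stone's extension theorem; with it, \<open>f\<^sup>*\<close> is well defined.\<close>

lemma beta_extension:
  fixes X :: "'a topology" and K :: "'b topology"
  assumes K: "compact_space K" "Hausdorff_space K" and f: "continuous_map X K f"
  shows "\<exists>g. continuous_map (beta X) K g \<and> (\<forall>x\<in>topspace X. g (beta_emb X x) = f x)"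
proof -
  define \<Phi> where "\<Phi> = (\<lambda>p :: ('a \<Rightarrow> real) \<Rightarrow> real. \<lambda>g\<in>unit_maps K. p (restrict (g \<circ> f) (topspace X)))"
  have unit: "restrict (g \<circ> f) (topspace X) \<in> unit_maps X" if "g \<in> unit_maps K" for g
    using that continuous_map_compose[OF f, of _ g] unfolding unit_maps_def
    by (auto intro: continuous_map_eq)
  have \<Phi>: "continuous_map (beta_cube X) (beta_cube K) \<Phi>"
    unfolding beta_cube_def[of K] continuous_map_componentwise
  proof (intro conjI ballI)
    fix g assume g: "g \<in> unit_maps K"
    have "continuous_map (beta_cube X) (top_of_set {0..1}) (\<lambda>p. p (restrict (g \<circ> f) (topspace X)))"
      unfolding beta_cube_def using unit[OF g] by (rule continuous_map_product_projection)
    then show "continuous_map (beta_cube X) (top_of_set {0..1}) (\<lambda>p. \<Phi> p g)"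
      using g by (simp add: \<Phi>_def)
  qed (auto simp: \<Phi>_def)
  have \<Phi>_emb: "\<Phi> (beta_emb X x) = beta_emb K (f x)" if "x \<in> topspace X" for x
    using that unit by (auto simp: \<Phi>_def beta_emb_def)
  have "Tychonoff_space K"
    unfolding Tychonoff_space_def
    using K compact_Hausdorff_or_regular_imp_normal_space normal_imp_completely_regular_space
    by blast
  then have "inj_on (beta_emb K) (topspace K)"
    using Tychonoff_separates[of K] unfolding beta_emb_def inj_on_def by (metis restrict_apply')
  let ?E = "subtopology (beta_cube K) (beta_emb K ` topspace K)"
  have "homeomorphic_map K ?E (beta_emb K)"
  proof (rule continuous_imp_homeomorphic_map)
    show "continuous_map K ?E (beta_emb K)"
      using beta_emb_continuous by (auto simp: continuous_map_in_subtopology)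
    show "beta_emb K ` topspace K = topspace ?E"
      using beta_emb_continuous continuous_map_image_subset_topspace
      by (fastforce simp: topspace_subtopology)
  qed (use K Hausdorff_beta_cube \<open>inj_on _ _\<close> in \<open>auto intro: Hausdorff_space_subtopology\<close>)
  then obtain d where d: "homeomorphic_maps K ?E (beta_emb K) d"
    using homeomorphic_map_maps by blast
  have "compactin (beta_cube K) (beta_emb K ` topspace K)"
    using K beta_emb_continuous image_compactin compact_space_def by metis
  then have cl: "closedin (beta_cube K) (beta_emb K ` topspace K)"
    using Hausdorff_beta_cube compactin_imp_closedin by blast
  have "\<Phi> ` (beta_cube X closure_of (beta_emb X ` topspace X))
        \<subseteq> beta_cube K closure_of (\<Phi> ` beta_emb X ` topspace X)"
    using \<Phi> continuous_map_image_closure_subset by blast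
  also have "\<dots> \<subseteq> beta_cube K closure_of (beta_emb K ` topspace K)"
    using \<Phi>_emb f continuous_map_image_subset_topspace[OF f] by (intro closure_of_mono) auto
  also have "\<dots> = beta_emb K ` topspace K"
    using cl closure_of_closedin by blast
  finally have "continuous_map (beta X) ?E \<Phi>"
    using \<Phi> unfolding beta_def
    by (auto simp: continuous_map_in_subtopology continuous_map_from_subtopology)
  then have "continuous_map (beta X) K (d \<circ> \<Phi>)"
    using d continuous_map_compose unfolding homeomorphic_maps_def by blast
  moreover have "(d \<circ> \<Phi>) (beta_emb X x) = f x" if "x \<in> topspace X" for x
    using that d \<Phi>_emb continuous_map_image_subset_topspace[OF f]
    by (auto simp: homeomorphic_maps_def)
  ultimately show ?thesis by blast
qed

lemma ex1_beta_ext: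
  assumes f: "f \<in> carrier (C_ring X)"
  shows "\<exists>!g. is_beta_ext X f g"
proof -
  let ?A = "Alexandroff_compactification euclideanreal"
  have H: "Hausdorff_space ?A"
    by (simp add: Hausdorff_space_Alexandroff_compactification locally_compact_space_euclidean)
  have "continuous_map X euclideanreal f"
    using f by (simp add: C_ring_def)
  then have "continuous_map X ?A (Some \<circ> f)"
    using continuous_map_Some continuous_map_compose by blast
  then obtain g where g: "continuous_map (beta X) ?A g" "\<forall>x\<in>topspace X. g (beta_emb X x) = Some (f x)"
    using beta_extension[of ?A X "Some \<circ> f"] H by auto
  have "is_beta_ext X f (restrict g (topspace (beta X)))"
    unfolding is_beta_ext_def using g beta_emb_in_beta[of _ X]
    by (auto intro: continuous_map_eq)
  moreover have "g1 = g2" if "is_beta_ext X f g1" "is_beta_ext X f g2" for g1 g2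
  proof (rule extensionalityI)
    fix p assume "p \<in> topspace (beta X)"
    then have "p \<in> beta X closure_of (beta_emb X ` topspace X)"
      by (simp add: beta_dense)
    then show "g1 p = g2 p"
      by (rule forall_in_closure_of_eq[OF _ H]) (use that in \<open>auto simp: is_beta_ext_def\<close>)
  qed (use that in \<open>auto simp: is_beta_ext_def\<close>)
  ultimately show ?thesis by blast
qed

definition upsilon :: "'a topology \<Rightarrow> (('a \<Rightarrow> real) \<Rightarrow> real) set" where
  "upsilon X = {p \<in> topspace (beta X). \<forall>f\<in>carrier (C_ring X). beta_ext X f p \<noteq> None}"

text \<open>\<open>X\<close> is identified with its image under \<^term>\<open>beta_emb X\<close>.\<close>

definition realcompact_space :: "'a topology \<Rightarrow> bool" where
  "realcompact_space X \<longleftrightarrow> upsilon X = beta_emb X ` topspace X"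

end

theory Submission
  imports Defs
begin

text \<open>An unbounded continuous function gives a sequence \<open>s\<close> in \<open>X\<close> whose values under it have gaps.
  A free ultrafilter \<open>U\<close> on \<open>\<nat>\<close> then determines a point \<open>p\<close> of \<open>\<beta>X - X\<close> in the closure of
  the sequence, and the ring \<open>A\<^sub>U\<close> of the functions with a finite limit along \<open>U\<close> is
  \<open>C(X \<union> {p})\<close>. By realcompactness its ring homomorphisms to \<open>\<real>\<close> are the evaluations at the points
  of \<open>X \<union> {p}\<close>, so an isomorphism \<open>A\<^sub>U \<simeq> A\<^sub>V\<close> permutes these points. It must match the two
  ideal points, the only ones without a countable neighbourhood base. Since the range of \<open>s\<close>
  is a zero set and disjoint zero sets have disjoint closures in \<open>\<beta>X\<close>, the induced permutation of
  \<open>X\<close> maps \<open>V\<close>-almost all points of \<open>s\<close> into the range of \<open>s\<close>; hence \<open>U\<close> is the image of \<open>V\<close>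
  under a map \<open>\<nat> \<Rightarrow> \<nat>\<close>. So each isomorphism class contains at most continuum many of the
  \<open>2\<^sup>c\<close> rings \<open>A\<^sub>U\<close>, where \<open>c\<close> is the cardinality of the continuum.\<close>

section \<open>Free ultrafilters on the natural numbers\<close>

text \<open>Ultrafilters are kept in the type \<open>filter\<close>, so that \<open>tendsto\<close>
  and \<open>filtermap\<close> provide limits along them and images under maps. Freeness on the
  natural numbers is written \<open>U \<le> sequentially\<close>.\<close>

definition ultrafilter :: "'a filter \<Rightarrow> bool" where
  "ultrafilter U \<longleftrightarrow> U \<noteq> bot \<and> (\<forall>P. eventually P U \<or> eventually (\<lambda>x. \<not> P x) U)"

lemma ultrafilter_not_iff:
  assumes "ultrafilter U"
  shows "eventually (\<lambda>x. \<not> P x) U \<longleftrightarrow> \<not> eventually P U"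
  using assms eventually_conj[of P U "\<lambda>x. \<not> P x"] eventually_False[of U]
  unfolding ultrafilter_def by auto

lemma ultrafilter_filtermap:
  assumes "ultrafilter U"
  shows "ultrafilter (filtermap f U)"
  using assms unfolding ultrafilter_def by (auto simp: filtermap_bot_iff eventually_filtermap)

text \<open>A smaller filter has more sets, so ultrafilters are minimal among proper filters: a set
  of \<open>V\<close> missing from \<open>U\<close> would have its complement in \<open>U\<close>,
  hence in \<open>V\<close>.\<close>

lemma ultrafilter_le_imp_eq:
  assumes U: "ultrafilter U" and "V \<le> U" "V \<noteq> bot"
  shows "V = U"
proof (rule antisym)
  show "U \<le> V"
  proof (rule filter_leI)
    fix P assume P: "eventually P V"
    show "eventually P U"
    proof (rule ccontr)
      assume "\<not> eventually P U"
      then have "eventually (\<lambda>x. \<not> P x) V"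
        using U \<open>V \<le> U\<close> ultrafilter_not_iff filter_leD by blast
      then show False
        using P \<open>V \<noteq> bot\<close> eventually_conj[OF P, of "\<lambda>x. \<not> P x"] eventually_False[of V] by auto
    qed
  qed
qed fact

text \<open>Zorn's lemma for the reversed order on the proper filters below \<open>F\<close>. The
  infimum of a nonempty chain is proper, since otherwise some member of the chain would already be
  \<open>bot\<close>.\<close>

lemma ex_ultrafilter_le:
  fixes F :: "'a filter"
  assumes "F \<noteq> bot"
  shows "\<exists>U \<le> F. ultrafilter U"
proof -
  define S where "S = {G. G \<noteq> bot \<and> G \<le> F}"
  let ?r = "{(G, H). G \<in> S \<and> H \<in> S \<and> H \<le> G}"
  have fld: "Field ?r = S"
    by (auto simp: Field_def)
  have po: "Partial_order ?r"
    unfolding partial_order_on_def preorder_on_def refl_on_def trans_def antisym_def fld by auto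
  have ub: "\<exists>u\<in>Field ?r. \<forall>a\<in>C. (a, u) \<in> ?r" if "C \<in> Chains ?r" for C
  proof (cases "C = {}")
    case True
    then show ?thesis using assms fld S_def by auto
  next
    case False
    have C: "C \<subseteq> S" "\<And>G H. G \<in> C \<Longrightarrow> H \<in> C \<Longrightarrow> G \<le> H \<or> H \<le> G"
      using that by (auto simp: Chains_def)
    have "Inf C \<noteq> bot"
    proof
      assume "Inf C = bot"
      then have "eventually (\<lambda>_. False) (Inf C)" by simp
      moreover have "eventually (\<lambda>_. False) (Inf C) \<longleftrightarrow> (\<exists>G\<in>C. eventually (\<lambda>_. False) G)"
      proof (rule eventually_Inf_base)
        show "\<exists>K\<in>C. K \<le> inf G H" if "G \<in> C" "H \<in> C" for G H
          using C(2)[OF that] that by (elim disjE) (auto simp: inf_absorb1 inf_absorb2)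
      qed fact
      ultimately show False
        using C(1) by (auto simp: S_def eventually_False)
    qed
    moreover have "Inf C \<le> F"
      using False C(1) S_def by (metis (mono_tags, lifting) Inf_lower2 all_not_in_conv mem_Collect_eq subsetD)
    ultimately have "Inf C \<in> S" by (simp add: S_def)
    then show ?thesis
      using C(1) fld by (auto intro!: bexI[of _ "Inf C"] Inf_lower)
  qed
  then obtain U where U: "U \<in> S" "\<And>G. G \<in> S \<Longrightarrow> G \<le> U \<Longrightarrow> G = U"
    using Zorns_po_lemma[OF po] unfolding fld by auto
  have "ultrafilter U"
    unfolding ultrafilter_def
  proof (intro conjI allI)
    fix P
    show "eventually P U \<or> eventually (\<lambda>x. \<not> P x) U"
    proof (rule ccontr)
      assume no: "\<not> ?thesis"
      \<comment> \<open>If \<open>U\<close> decides neither \<open>P\<close> nor its negation, then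
        adjoining \<open>{x. P x}\<close> leaves it proper, against minimality.\<close>
      define G where "G = inf U (principal {x. P x})"
      have "G \<noteq> bot"
        using no unfolding G_def trivial_limit_def eventually_inf_principal by auto
      moreover have "G \<le> U" by (simp add: G_def)
      ultimately have "G = U"
        using U by (auto simp: S_def)
      moreover have "eventually P G" by (simp add: G_def eventually_inf_principal)
      ultimately show False using no by simp
    qed
  qed (use U in \<open>simp add: S_def\<close>)
  then show ?thesis using U(1) by (auto simp: S_def)
qed

text \<open>The image ultrafilter lives on a compact set and so has a cluster point; by minimality
  it converges there.\<close>

lemma ultrafilter_bounded_tendsto:
  fixes f :: "'a \<Rightarrow> 'b::heine_borel"
  assumes U: "ultrafilter U" and b: "bounded (f ` {x. P x})" "eventually P U"
  shows "\<exists>l. (f \<longlongrightarrow> l) U"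
proof -
  let ?K = "closure (f ` {x. P x})"
  have "compact ?K" using b by (simp add: compact_closure)
  moreover have fu: "ultrafilter (filtermap f U)" using U by (rule ultrafilter_filtermap)
  moreover have "eventually (\<lambda>y. y \<in> ?K) (filtermap f U)"
    unfolding eventually_filtermap
    by (rule eventually_mono[OF b(2)]) (use closure_subset[of "f ` {x. P x}"] in auto)
  ultimately obtain l where l: "inf (nhds l) (filtermap f U) \<noteq> bot"
    unfolding ultrafilter_def
    using compact_filter[THEN iffD1, rule_format, of ?K "filtermap f U"] by auto
  have "inf (nhds l) (filtermap f U) = filtermap f U"
    by (rule ultrafilter_le_imp_eq[OF fu _ l]) simp
  then have "(f \<longlongrightarrow> l) U"
    unfolding filterlim_def by (metis inf.cobounded1)
  then show ?thesis by blast
qed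

text \<open>The sets \<open>I A = {(m, L). A \<inter> {..<m} \<in> set (map set L)}\<close> form an independent family
  of continuum many subsets of a countable set.\<close>

lemma ex_free_ultrafilters:
  "\<exists>g :: nat set set \<Rightarrow> nat filter. inj g \<and> (\<forall>\<A>. ultrafilter (g \<A>) \<and> g \<A> \<le> sequentially)"
proof -
  \<comment> \<open>An index \<open>(m, L)\<close> codes a cut-off \<open>m\<close> and a finite
    family of finite sets. Lists replace sets so that the index type is countable.\<close>
  define I :: "nat set \<Rightarrow> (nat \<times> nat list list) set"
    where "I A = {(m, L). A \<inter> {..<m} \<in> set ` set L}" for A
  define J :: "nat set set \<Rightarrow> nat set \<Rightarrow> (nat \<times> nat list list) set"
    where "J \<A> A = (if A \<in> \<A> then I A else - I A)" for \<A> A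
  \<comment> \<open>The sets \<open>D k\<close> will make the ultrafilters free.\<close>
  define D :: "nat \<Rightarrow> (nat \<times> nat list list) set" where "D k = {(m, L). k \<le> m}" for k
  define F :: "nat set set \<Rightarrow> (nat \<times> nat list list) filter"
    where "F \<A> = Inf (principal ` (range (J \<A>) \<union> range D))" for \<A>
  have "F \<A> \<noteq> bot" for \<A>
    unfolding F_def
  proof (rule Inf_filter_not_bot)
    fix X assume X: "X \<subseteq> principal ` (range (J \<A>) \<union> range D)" "finite X"
    then obtain Y where Y: "Y \<subseteq> range (J \<A>) \<union> range D" "finite Y" "X = principal ` Y"
      by (meson finite_subset_image)
    have "finite (Y \<inter> range (J \<A>))" "finite (Y \<inter> range D)" using Y by auto
    then obtain S K where SK: "finite S" "finite K" "Y \<inter> range (J \<A>) = J \<A> ` S" "Y \<inter> range D = D ` K"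
      using finite_subset_image[of "Y \<inter> range (J \<A>)" "J \<A>" UNIV]
        finite_subset_image[of "Y \<inter> range D" D UNIV] by auto
    \<comment> \<open>Finitely many sets are told apart below some \<open>M\<close>: it exceeds the
      least element of each symmetric difference.\<close>
    have "\<exists>M. \<forall>A\<in>S. \<forall>B\<in>S. A \<noteq> B \<longrightarrow> A \<inter> {..<M} \<noteq> B \<inter> {..<M}"
    proof -
      define d where "d A B = (LEAST i. i \<in> (A - B) \<union> (B - A))" for A B :: "nat set"
      have d: "d A B \<in> (A - B) \<union> (B - A)" if "A \<noteq> B" for A B
        unfolding d_def by (rule LeastI_ex[of "\<lambda>i. i \<in> (A - B) \<union> (B - A)"]) (use that in blast)
      have "finite ((\<lambda>(A, B). d A B) ` (S \<times> S))" using SK by simp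
      then obtain M where M: "\<And>A B. A \<in> S \<Longrightarrow> B \<in> S \<Longrightarrow> d A B < M"
        unfolding finite_nat_set_iff_bounded by fastforce
      show ?thesis
      proof (intro exI[of _ M] ballI impI notI)
        fix A B assume "A \<in> S" "B \<in> S" "A \<noteq> B" "A \<inter> {..<M} = B \<inter> {..<M}"
        then show False using d[of A B] M[of A B] by blast
      qed
    qed
    then obtain M where M: "\<forall>A\<in>S. \<forall>B\<in>S. A \<noteq> B \<longrightarrow> A \<inter> {..<M} \<noteq> B \<inter> {..<M}" ..
    define m where "m = Max (insert M K)"
    have m: "M \<le> m" "\<And>k. k \<in> K \<Longrightarrow> k \<le> m" using SK by (auto simp: m_def)
    have sep: "A \<inter> {..<m} \<noteq> B \<inter> {..<m}" if "A \<in> S" "B \<in> S" "A \<noteq> B" for A B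
    proof
      assume eq: "A \<inter> {..<m} = B \<inter> {..<m}"
      have "{..<M} = {..<m} \<inter> {..<M}" using m by auto
      then have "A \<inter> {..<M} = B \<inter> {..<M}" using eq by (metis Int_assoc)
      then show False using M that by simp
    qed
    \<comment> \<open>\<open>L\<close> lists the traces below \<open>m\<close> of exactly those sets
      of \<open>S\<close> that lie in \<open>\<A>\<close>. The other sets of \<open>S\<close> have
      different traces, so \<open>(m, L)\<close> satisfies all the finitely many constraints at
      once.\<close>
    have "finite ((\<lambda>A. sorted_list_of_set (A \<inter> {..<m})) ` (S \<inter> \<A>))" using SK by simp
    then obtain L where L: "set L = (\<lambda>A. sorted_list_of_set (A \<inter> {..<m})) ` (S \<inter> \<A>)"
      using finite_list by blast
    have "set ` set L = (\<lambda>A. A \<inter> {..<m}) ` (S \<inter> \<A>)"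
      unfolding L image_image by simp
    then have L': "(m, L) \<in> I A \<longleftrightarrow> A \<inter> {..<m} \<in> (\<lambda>A. A \<inter> {..<m}) ` (S \<inter> \<A>)" for A
      by (simp add: I_def)
    have "(m, L) \<in> J \<A> A" if "A \<in> S" for A
    proof (cases "A \<in> \<A>")
      case False
      then have "A \<inter> {..<m} \<notin> (\<lambda>A. A \<inter> {..<m}) ` (S \<inter> \<A>)" using sep[OF that] by fast
      then show ?thesis using False L' by (simp add: J_def)
    qed (use that L' in \<open>simp add: J_def\<close>)
    moreover have "(m, L) \<in> D k" if "k \<in> K" for k using that m by (simp add: D_def)
    moreover have "Y = Y \<inter> range (J \<A>) \<union> Y \<inter> range D" using Y(1) by blast
    then have "Y = J \<A> ` S \<union> D ` K" unfolding SK(3,4) .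
    ultimately have "(m, L) \<in> \<Inter> Y" by auto
    moreover have "Inf X = principal (\<Inter> Y)"
    proof -
      have "finite Y \<Longrightarrow> Inf (principal ` Y) = principal (\<Inter> Y)" for Y :: "(nat \<times> nat list list) set set"
        by (induction Y rule: finite_induct) auto
      then show ?thesis using Y by simp
    qed
    ultimately show "Inf X \<noteq> bot" by (auto simp: principal_eq_bot_iff)
  qed
  then have "\<forall>\<A>. \<exists>U. U \<le> F \<A> \<and> ultrafilter U" using ex_ultrafilter_le by blast
  then obtain G where "\<forall>\<A>. G \<A> \<le> F \<A> \<and> ultrafilter (G \<A>)" by (rule choice[THEN exE])
  then have G: "G \<A> \<le> F \<A>" "ultrafilter (G \<A>)" for \<A> by auto
  have GJ: "eventually (\<lambda>i. i \<in> J \<A> A) (G \<A>)" for \<A> A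
  proof -
    have "F \<A> \<le> principal (J \<A> A)" unfolding F_def by (intro Inf_lower) auto
    then show ?thesis using G(1) order_trans le_principal by blast
  qed
  have GD: "eventually (\<lambda>i. i \<in> D k) (G \<A>)" for \<A> k
  proof -
    have "F \<A> \<le> principal (D k)" unfolding F_def by (intro Inf_lower) auto
    then show ?thesis using G(1) order_trans le_principal by blast
  qed
  define g :: "nat set set \<Rightarrow> nat filter" where "g \<A> = filtermap to_nat (G \<A>)" for \<A>
  have injG: "\<A> = \<B>" if "G \<A> = G \<B>" for \<A> \<B>
  proof (rule ccontr)
    \<comment> \<open>A set in just one of the two families makes its two \<open>J\<close>-sets
      complementary, yet both would be large.\<close>
    assume "\<A> \<noteq> \<B>"
    then obtain A where "(A \<in> \<A>) \<noteq> (A \<in> \<B>)" by blast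
    then have "J \<A> A \<inter> J \<B> A = {}" by (auto simp: J_def)
    moreover have "eventually (\<lambda>i. i \<in> J \<A> A \<and> i \<in> J \<B> A) (G \<A>)"
      using GJ[of \<A> A] GJ[of \<B> A, folded that] by (rule eventually_conj)
    ultimately have "eventually (\<lambda>i. False) (G \<A>)"
      by (auto elim!: eventually_mono)
    then show False using G(2) by (simp add: ultrafilter_def eventually_False)
  qed
  have "inj g"
  proof (rule injI)
    fix \<A> \<B> assume "g \<A> = g \<B>"
    then have "filtermap (from_nat :: nat \<Rightarrow> nat \<times> nat list list) (g \<A>) = filtermap from_nat (g \<B>)" by simp
    then have "G \<A> = G \<B>" by (simp add: g_def filtermap_filtermap filtermap_ident)
    then show "\<A> = \<B>" by (rule injG)
  qed
  moreover have "g \<A> \<le> sequentially" for \<A>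
    unfolding le_sequentially g_def eventually_filtermap
  proof
    fix N
    define e where "e n = fst (from_nat n :: nat \<times> nat list list)" for n
    \<comment> \<open>\<open>k\<close> exceeds the first component of every index coded by a number
      up to \<open>N\<close>, so no index in \<open>D k\<close> has so small a code.\<close>
    define k where "k = Suc (Max (e ` {..N}))"
    have "N \<le> to_nat i" if "i \<in> D k" for i :: "nat \<times> nat list list"
    proof (rule ccontr)
      assume "\<not> ?thesis"
      then have "e (to_nat i) \<le> Max (e ` {..N})" by (intro Max_ge imageI) auto
      then show False using that by (auto simp: D_def k_def e_def)
    qed
    then show "eventually (\<lambda>i. N \<le> to_nat i) (G \<A>)"
      using GD[of k \<A>] by (auto elim: eventually_mono)
  qed
  ultimately show ?thesis
    using G(2) ultrafilter_filtermap unfolding g_def by blast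
qed

section \<open>Cardinal arithmetic for systems of representatives\<close>

text \<open>With classes of size at most continuum, \<open>T\<close> times the continuum dominates
  the double power set of the naturals. By Cantor \<open>T\<close> is not dominated by the
  continuum, so it dominates the continuum and absorbs that factor.\<close>

lemma ex_large_set_of_representatives:
  fixes R :: "nat set set \<Rightarrow> nat set set \<Rightarrow> bool"
  assumes "equivp R"
    and small: "\<And>\<A>. {\<B>. R \<A> \<B>} \<lesssim> (UNIV :: (nat \<Rightarrow> nat) set)"
  shows "\<exists>T. Pow (Pow (UNIV :: nat set)) \<lesssim> T \<and> (\<forall>\<A>\<in>T. \<forall>\<B>\<in>T. R \<A> \<B> \<longrightarrow> \<A> = \<B>)"
proof -
  define rep where "rep \<A> = (SOME \<B>. R \<A> \<B>)" for \<A>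
  define T where "T = range rep"
  have refl: "R \<A> \<A>" for \<A> using assms(1) by (simp add: equivp_reflp)
  have R_rep: "R \<A> (rep \<A>)" for \<A>
    unfolding rep_def using refl by (rule someI)
  have rep_eq: "rep \<A> = rep \<B>" if "R \<A> \<B>" for \<A> \<B>
    using assms(1) that unfolding rep_def equivp_def by simp
  have le: "(UNIV :: nat set set set) \<lesssim> T \<times> (UNIV :: (nat \<Rightarrow> nat) set)"
  proof -
    have "\<forall>\<A>. \<exists>h. inj_on h {\<B>. R \<A> \<B>} \<and> h ` {\<B>. R \<A> \<B>} \<subseteq> (UNIV :: (nat \<Rightarrow> nat) set)"
      using small unfolding lepoll_def by blast
    then obtain h :: "nat set set \<Rightarrow> nat set set \<Rightarrow> nat \<Rightarrow> nat" where h: "inj_on (h \<A>) {\<B>. R \<A> \<B>}" for \<A>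
      by metis
    have sym: "R (rep \<A>) \<A>" for \<A> using R_rep assms(1) by (meson equivp_symp)
    \<comment> \<open>A family is recovered from its representative together with its label inside
      the class of that representative.\<close>
    have "inj (\<lambda>\<A>. (rep \<A>, h (rep \<A>) \<A>))"
    proof (rule injI)
      fix \<A> \<B> assume "(rep \<A>, h (rep \<A>) \<A>) = (rep \<B>, h (rep \<B>) \<B>)"
      then show "\<A> = \<B>" using h[of "rep \<A>"] sym[of \<A>] sym[of \<B>] unfolding inj_on_def by auto
    qed
    then show ?thesis unfolding lepoll_def by (intro exI[of _ "\<lambda>\<A>. (rep \<A>, h (rep \<A>) \<A>)"]) (auto simp: T_def)
  qed
  have "T \<times> (UNIV :: (nat \<Rightarrow> nat) set) \<lesssim> T"
  proof -
    let ?c = "UNIV :: nat set set"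
    \<comment> \<open>A map is coded by its graph, as a set of encoded pairs.\<close>
    have "inj (\<lambda>f :: nat \<Rightarrow> nat. {prod_encode (n, f n) |n. True})"
    proof (rule injI, rule ext)
      fix f g :: "nat \<Rightarrow> nat" and n
      assume "{prod_encode (n, f n) |n. True} = {prod_encode (n, g n) |n. True}"
      then have "prod_encode (n, f n) \<in> {prod_encode (n, g n) |n. True}" by blast
      then show "f n = g n" by (auto simp: prod_encode_eq)
    qed
    then have fn: "(UNIV :: (nat \<Rightarrow> nat) set) \<lesssim> ?c"
      unfolding lepoll_def by blast
    have inf: "infinite ?c" by (simp add: Finite_Set.finite_set)
    have total: "A \<lesssim> B \<or> B \<lesssim> A" for A :: "nat set set set" and B :: "nat set set"
      using ordLeq_total[OF card_of_Well_order card_of_Well_order, of A B]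
      by (simp add: card_of_ordLeq[symmetric] lepoll_def)
    have square: "A \<times> A \<lesssim> A" if "infinite A" for A :: "'b set"
      using card_of_Times_same_infinite[OF that] eqpoll_iff_card_of_ordIso eqpoll_imp_lepoll by blast
    have "\<not> T \<lesssim> ?c"
    proof
      assume "T \<lesssim> ?c"
      then have "T \<times> (UNIV :: (nat \<Rightarrow> nat) set) \<lesssim> ?c \<times> ?c"
        using fn by (rule times_lepoll_mono)
      then have "Pow ?c \<lesssim> ?c"
        using lepoll_trans[OF lepoll_trans[OF le] square[OF inf]] by simp
      then show False
        using lesspoll_Pow_self[of ?c] lepoll_antisym[of "Pow ?c" ?c] lepoll_Pow_self[of ?c]
        by (auto simp: lesspoll_def eqpoll_sym)
    qed
    then have "?c \<lesssim> T" using total by blast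
    then have "T \<times> (UNIV :: (nat \<Rightarrow> nat) set) \<lesssim> T \<times> T"
      by (intro times_lepoll_mono lepoll_refl lepoll_trans[OF fn])
    moreover have "infinite T" using lepoll_trans[OF inf[unfolded infinite_le_lepoll] \<open>?c \<lesssim> T\<close>] by (simp add: infinite_le_lepoll)
    ultimately show ?thesis using lepoll_trans[OF _ square[of T]] by blast
  qed
  with le have "(UNIV :: nat set set set) \<lesssim> T" by (rule lepoll_trans)
  moreover have "\<A> = \<B>" if AB_T: "\<A> \<in> T" "\<B> \<in> T" "R \<A> \<B>" for \<A> \<B>
  proof -
    obtain \<A>' \<B>' where AB: "\<A> = rep \<A>'" "\<B> = rep \<B>'"
      using AB_T unfolding T_def by blast
    then have "R \<A>' \<B>'" using R_rep AB_T(3) assms(1) by (meson equivp_symp equivp_transp)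
    then show ?thesis using AB rep_eq by simp
  qed
  ultimately show ?thesis by auto
qed

section \<open>Characters of intermediate rings\<close>

lemma C_ring_simps:
  "carrier (C_ring X) = {f \<in> extensional (topspace X). continuous_map X euclideanreal f}"
  "f \<otimes>\<^bsub>C_ring X\<^esub> g = (\<lambda>x\<in>topspace X. f x * g x)"
  "f \<oplus>\<^bsub>C_ring X\<^esub> g = (\<lambda>x\<in>topspace X. f x + g x)"
  "\<one>\<^bsub>C_ring X\<^esub> = (\<lambda>x\<in>topspace X. 1)"
  "\<zero>\<^bsub>C_ring X\<^esub> = (\<lambda>x\<in>topspace X. 0)"
  by (simp_all add: C_ring_def)

lemma restrict_in_C_ring:
  assumes "continuous_map X euclideanreal f"
  shows "(\<lambda>x\<in>topspace X. f x) \<in> carrier (C_ring X)"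
  using assms by (auto simp: C_ring_simps intro: continuous_map_eq)

lemma restrict_in_C_bdd:
  assumes "continuous_map X euclideanreal f" and "\<And>x. x \<in> topspace X \<Longrightarrow> \<bar>f x\<bar> \<le> B"
  shows "(\<lambda>x\<in>topspace X. f x) \<in> C_bdd X"
  unfolding C_bdd_def using restrict_in_C_ring[OF assms(1)] assms(2) by (auto intro!: boundedI[of _ B])

lemma C_ring_continuous: "f \<in> carrier (C_ring X) \<Longrightarrow> continuous_map X euclideanreal f"
  by (simp add: C_ring_simps)

lemma C_ring_restrict: "f \<in> carrier (C_ring X) \<Longrightarrow> (\<lambda>x\<in>topspace X. f x) = f"
  by (simp add: C_ring_simps extensional_restrict)

lemma C_ring_eqI:
  assumes "f \<in> carrier (C_ring X)" "g \<in> carrier (C_ring X)" "\<And>x. x \<in> topspace X \<Longrightarrow> f x = g x"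
  shows "f = g"
  using assms by (auto simp: C_ring_simps intro: extensionalityI)

lemma cring_C_ring: "cring (C_ring X)"
proof (intro cringI abelian_groupI comm_monoidI)
  fix f assume f: "f \<in> carrier (C_ring X)"
  have "(\<lambda>x\<in>topspace X. - f x) \<in> carrier (C_ring X)"
    using f by (intro restrict_in_C_ring) (auto simp: C_ring_simps intro: continuous_intros)
  then show "\<exists>g\<in>carrier (C_ring X). g \<oplus>\<^bsub>C_ring X\<^esub> f = \<zero>\<^bsub>C_ring X\<^esub>"
    by (rule rev_bexI) (auto simp: C_ring_simps intro: restrict_ext)
  show "\<one>\<^bsub>C_ring X\<^esub> \<otimes>\<^bsub>C_ring X\<^esub> f = f" "\<zero>\<^bsub>C_ring X\<^esub> \<oplus>\<^bsub>C_ring X\<^esub> f = f"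
    using f by (auto simp: C_ring_simps extensional_def)
  fix g assume g: "g \<in> carrier (C_ring X)"
  show "f \<otimes>\<^bsub>C_ring X\<^esub> g \<in> carrier (C_ring X)" "f \<oplus>\<^bsub>C_ring X\<^esub> g \<in> carrier (C_ring X)"
    using f g restrict_in_C_ring[of X "\<lambda>x. f x * g x"] restrict_in_C_ring[of X "\<lambda>x. f x + g x"]
    by (simp_all add: C_ring_simps continuous_map_real_mult continuous_map_add)
qed (auto simp: C_ring_simps algebra_simps intro!: restrict_ext continuous_map_eq[of X _ "\<lambda>_. _"])

lemma bounded_in_intermediate_ring:
  assumes "intermediate_ring X A" "continuous_map X euclideanreal f" "\<And>x. x \<in> topspace X \<Longrightarrow> \<bar>f x\<bar> \<le> B"
  shows "(\<lambda>x\<in>topspace X. f x) \<in> A"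
  using assms restrict_in_C_bdd unfolding intermediate_ring_def by blast

text \<open>Negation is multiplication by the bounded constant \<open>- 1\<close>, so sums and
  products suffice.\<close>

lemma intermediate_ringI:
  assumes "A \<subseteq> carrier (C_ring X)" "C_bdd X \<subseteq> A"
    and "\<And>f g. f \<in> A \<Longrightarrow> g \<in> A \<Longrightarrow> (\<lambda>x\<in>topspace X. f x + g x) \<in> A"
    and "\<And>f g. f \<in> A \<Longrightarrow> g \<in> A \<Longrightarrow> (\<lambda>x\<in>topspace X. f x * g x) \<in> A"
  shows "intermediate_ring X A"
  unfolding intermediate_ring_def
proof
  interpret cring "C_ring X" by (rule cring_C_ring)
  have const: "(\<lambda>x\<in>topspace X. c) \<in> A" for c
    using assms(2) restrict_in_C_bdd[of X "\<lambda>_. c" "\<bar>c\<bar>"] by auto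
  show "subring A (C_ring X)"
  proof (rule subringI)
    fix f assume f: "f \<in> A"
    then have fC: "f \<in> carrier (C_ring X)" using assms(1) by auto
    have "(\<lambda>x\<in>topspace X. f x * (\<lambda>x\<in>topspace X. - 1) x) \<in> A"
      using f const[of "- 1"] by (rule assms(4))
    moreover have "\<ominus>\<^bsub>C_ring X\<^esub> f = (\<lambda>x\<in>topspace X. f x * (\<lambda>x\<in>topspace X. - 1) x)"
    proof (rule minus_equality)
      show "(\<lambda>x\<in>topspace X. f x * (\<lambda>x\<in>topspace X. - 1) x) \<oplus>\<^bsub>C_ring X\<^esub> f = \<zero>\<^bsub>C_ring X\<^esub>"
        by (auto simp: C_ring_simps intro: restrict_ext)
    qed (use calculation assms(1) fC in auto)
    ultimately show "\<ominus>\<^bsub>C_ring X\<^esub> f \<in> A" by simp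
  qed (use assms const in \<open>auto simp: C_ring_simps\<close>)
qed fact

text \<open>A unital ring homomorphism from \<open>A\<close> to the reals; its values off
  \<open>A\<close> are left free.\<close>

definition character :: "'a topology \<Rightarrow> ('a \<Rightarrow> real) set \<Rightarrow> (('a \<Rightarrow> real) \<Rightarrow> real) \<Rightarrow> bool" where
  "character X A \<theta> \<longleftrightarrow>
     (\<forall>f\<in>A. \<forall>g\<in>A. \<theta> (\<lambda>x\<in>topspace X. f x + g x) = \<theta> f + \<theta> g \<and>
                  \<theta> (\<lambda>x\<in>topspace X. f x * g x) = \<theta> f * \<theta> g) \<and>
     \<theta> (\<lambda>x\<in>topspace X. 1) = 1"

text \<open>Nonnegative reals are squares, so \<open>r\<close> is monotone; it fixes the rationals,
  and density does the rest.\<close>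

lemma real_ring_hom_eq_id:
  fixes r :: "real \<Rightarrow> real"
  assumes add: "\<And>x y. r (x + y) = r x + r y" and mult: "\<And>x y. r (x * y) = r x * r y" and one: "r 1 = 1"
  shows "r x = x"
proof -
  interpret r: additive r by unfold_locales (rule add)
  have nonneg: "0 \<le> r x" if "0 \<le> x" for x
    using mult[of "sqrt x" "sqrt x"] that by simp
  have mono: "r x \<le> r y" if "x \<le> y" for x y
    using nonneg[of "y - x"] that by (simp add: r.diff)
  have nat: "r (of_nat n) = of_nat n" for n
    by (induction n) (simp_all add: r.zero add one)
  have int: "r (of_int n) = of_int n" for n
    by (cases n rule: int_diff_cases) (simp add: r.diff nat)
  have rat: "r (of_rat q) = of_rat q" for q
  proof (cases q)
    case (Fract a b)
    then have q: "of_rat q * of_int b = (of_int a :: real)" by (simp add: of_rat_rat)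
    then have "r (of_rat q) * of_int b = of_int a" using mult[of "of_rat q" "of_int b"] int by metis
    with q show ?thesis using Fract by (metis mult_right_cancel of_int_eq_0_iff less_numeral_extra(3))
  qed
  show ?thesis
  proof (rule ccontr)
    assume "r x \<noteq> x"
    then consider "r x < x" | "x < r x" by linarith
    then show False
    proof cases
      case 1
      then obtain q where "r x < of_rat q" "of_rat q < x" using of_rat_dense by blast
      then show False using mono[of "of_rat q" x] rat[of q] by simp
    next
      case 2
      then obtain q where "x < of_rat q" "of_rat q < r x" using of_rat_dense by blast
      then show False using mono[of x "of_rat q"] rat[of q] by simp
    qed
  qed
qed

locale intermediate_character =
  fixes X :: "'a topology" and A :: "('a \<Rightarrow> real) set" and \<theta> :: "('a \<Rightarrow> real) \<Rightarrow> real"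
  assumes A: "intermediate_ring X A" and \<theta>: "character X A \<theta>"
begin

lemma A_subset: "A \<subseteq> carrier (C_ring X)"
  using A subringE(1) unfolding intermediate_ring_def by blast

lemma bounded_in_A:
  "continuous_map X euclideanreal f \<Longrightarrow> (\<And>x. x \<in> topspace X \<Longrightarrow> \<bar>f x\<bar> \<le> B) \<Longrightarrow> (\<lambda>x\<in>topspace X. f x) \<in> A"
  using A by (rule bounded_in_intermediate_ring)

lemma const_in_A: "(\<lambda>x\<in>topspace X. c) \<in> A"
  using bounded_in_A[of "\<lambda>_. c" "\<bar>c\<bar>"] by simp

lemma add_in_A: "f \<in> A \<Longrightarrow> g \<in> A \<Longrightarrow> (\<lambda>x\<in>topspace X. f x + g x) \<in> A"
  and mult_in_A: "f \<in> A \<Longrightarrow> g \<in> A \<Longrightarrow> (\<lambda>x\<in>topspace X. f x * g x) \<in> A"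
  using A subringE(6,7)[of A "C_ring X"] unfolding intermediate_ring_def by (auto simp: C_ring_simps)

lemma \<theta>_add: "f \<in> A \<Longrightarrow> g \<in> A \<Longrightarrow> \<theta> (\<lambda>x\<in>topspace X. f x + g x) = \<theta> f + \<theta> g"
  and \<theta>_mult: "f \<in> A \<Longrightarrow> g \<in> A \<Longrightarrow> \<theta> (\<lambda>x\<in>topspace X. f x * g x) = \<theta> f * \<theta> g"
  using \<theta> unfolding character_def by auto

lemma \<theta>_const: "\<theta> (\<lambda>x\<in>topspace X. c) = c"
proof (rule real_ring_hom_eq_id)
  show "\<theta> (\<lambda>x\<in>topspace X. 1) = 1" using \<theta> by (simp add: character_def)
  show "\<theta> (\<lambda>x\<in>topspace X. c + d) = \<theta> (\<lambda>x\<in>topspace X. c) + \<theta> (\<lambda>x\<in>topspace X. d)" for c d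
    using \<theta>_add[OF const_in_A const_in_A, of c d] by (simp cong: restrict_cong)
  show "\<theta> (\<lambda>x\<in>topspace X. c * d) = \<theta> (\<lambda>x\<in>topspace X. c) * \<theta> (\<lambda>x\<in>topspace X. d)" for c d
    using \<theta>_mult[OF const_in_A const_in_A, of c d] by (simp cong: restrict_cong)
qed

lemma diff_const:
  assumes "f \<in> A"
  shows "(\<lambda>x\<in>topspace X. f x - c) \<in> A" "\<theta> (\<lambda>x\<in>topspace X. f x - c) = \<theta> f - c"
proof -
  have eq: "(\<lambda>x\<in>topspace X. f x + (\<lambda>x\<in>topspace X. - c) x) = (\<lambda>x\<in>topspace X. f x - c)"
    by (rule restrict_ext) simp
  show "(\<lambda>x\<in>topspace X. f x - c) \<in> A"
    using add_in_A[OF assms const_in_A, of "- c"] unfolding eq .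
  show "\<theta> (\<lambda>x\<in>topspace X. f x - c) = \<theta> f - c"
    using \<theta>_add[OF assms const_in_A, of "- c"] unfolding eq \<theta>_const by simp
qed

lemma square_diff:
  assumes "f \<in> A"
  shows "(\<lambda>x\<in>topspace X. (f x - c)\<^sup>2) \<in> A" "\<theta> (\<lambda>x\<in>topspace X. (f x - c)\<^sup>2) = (\<theta> f - c)\<^sup>2"
proof -
  let ?g = "\<lambda>x\<in>topspace X. f x - c"
  have eq: "(\<lambda>x\<in>topspace X. ?g x * ?g x) = (\<lambda>x\<in>topspace X. (f x - c)\<^sup>2)"
    by (rule restrict_ext) (simp add: power2_eq_square)
  show "(\<lambda>x\<in>topspace X. (f x - c)\<^sup>2) \<in> A"
    using mult_in_A[of ?g ?g] diff_const[OF assms] unfolding eq by blast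
  show "\<theta> (\<lambda>x\<in>topspace X. (f x - c)\<^sup>2) = (\<theta> f - c)\<^sup>2"
    using \<theta>_mult[of ?g ?g] diff_const[OF assms] unfolding eq by (simp add: power2_eq_square)
qed

text \<open>The reciprocal of a function bounded away from 0 is bounded, hence in every intermediate
  ring.\<close>

lemma inverse_in_A:
  assumes "h \<in> A" "0 < \<epsilon>" "\<And>x. x \<in> topspace X \<Longrightarrow> \<epsilon> \<le> h x"
  shows "(\<lambda>x\<in>topspace X. 1 / h x) \<in> A" "\<theta> h * \<theta> (\<lambda>x\<in>topspace X. 1 / h x) = 1"
proof -
  have pos: "0 < h x" if "x \<in> topspace X" for x using assms(3)[OF that] assms(2) by linarith
  have "continuous_map X euclideanreal (\<lambda>x. 1 / h x)"
    using assms(1) A_subset pos by (intro continuous_intros) (force simp: C_ring_simps)+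
  moreover have "\<bar>1 / h x\<bar> \<le> 1 / \<epsilon>" if "x \<in> topspace X" for x
    using assms(3)[OF that] pos[OF that] assms(2) by (simp add: frac_le)
  ultimately show k: "(\<lambda>x\<in>topspace X. 1 / h x) \<in> A" by (rule bounded_in_A)
  have "(\<lambda>x\<in>topspace X. h x * (\<lambda>x\<in>topspace X. 1 / h x) x) = (\<lambda>x\<in>topspace X. 1)"
    by (rule restrict_ext) (use pos in force)
  then show "\<theta> h * \<theta> (\<lambda>x\<in>topspace X. 1 / h x) = 1"
    using \<theta>_mult[OF assms(1) k] \<theta>_const[of 1] by simp
qed

text \<open>Otherwise a function in the kernel of \<open>\<theta>\<close>, dominating all the
  squares \<open>(f x - \<theta> f)\<^sup>2\<close>, would be at least
  \<open>\<epsilon>\<^sup>2\<close> everywhere and thus invertible in \<open>A\<close>.\<close>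

lemma ex_approximating_point:
  assumes "finite F" "F \<subseteq> A" "0 < \<epsilon>"
  shows "\<exists>x\<in>topspace X. \<forall>f\<in>F. \<bar>f x - \<theta> f\<bar> < \<epsilon>"
proof (rule ccontr)
  assume no: "\<not> ?thesis"
  \<comment> \<open>\<open>h\<close> is the sum of the squares over \<open>F\<close>; asking only
    for an upper bound keeps the induction simple.\<close>
  have "\<exists>h\<in>A. \<theta> h = 0 \<and> (\<forall>x\<in>topspace X. 0 \<le> h x \<and> (\<forall>f\<in>F. (f x - \<theta> f)\<^sup>2 \<le> h x))"
    using assms(1,2)
  proof (induction F rule: finite_induct)
    case empty
    show ?case by (rule bexI[OF _ const_in_A[of 0]], intro conjI, rule \<theta>_const) simp
  next
    case (insert f F)
    then obtain h where h: "h \<in> A" "\<theta> h = 0"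
        "\<And>x. x \<in> topspace X \<Longrightarrow> 0 \<le> h x" "\<And>x g. x \<in> topspace X \<Longrightarrow> g \<in> F \<Longrightarrow> (g x - \<theta> g)\<^sup>2 \<le> h x"
      by blast
    let ?s = "\<lambda>x\<in>topspace X. (f x - \<theta> f)\<^sup>2"
    have s: "?s \<in> A" "\<theta> ?s = 0" using square_diff[of f "\<theta> f"] insert.prems by auto
    show ?case
    proof (rule bexI[of _ "\<lambda>x\<in>topspace X. h x + ?s x"], intro conjI ballI)
      show "\<theta> (\<lambda>x\<in>topspace X. h x + ?s x) = 0" using \<theta>_add[OF h(1) s(1)] h(2) s(2) by simp
      fix x assume x: "x \<in> topspace X"
      then show "0 \<le> (\<lambda>x\<in>topspace X. h x + ?s x) x" using h(3)[OF x] by simp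
      fix g assume "g \<in> insert f F"
      then show "(g x - \<theta> g)\<^sup>2 \<le> (\<lambda>x\<in>topspace X. h x + ?s x) x"
        using x h(3)[OF x] h(4)[OF x, of g] by (auto intro: add_increasing2)
    qed (use h s add_in_A in blast)
  qed
  then obtain h where h: "h \<in> A" "\<theta> h = 0"
      "\<And>x. x \<in> topspace X \<Longrightarrow> \<forall>f\<in>F. (f x - \<theta> f)\<^sup>2 \<le> h x" by blast
  have "\<epsilon>\<^sup>2 \<le> h x" if x: "x \<in> topspace X" for x
  proof -
    obtain f where f: "f \<in> F" "\<epsilon> \<le> \<bar>f x - \<theta> f\<bar>" using no x by force
    then have "\<epsilon>\<^sup>2 \<le> (f x - \<theta> f)\<^sup>2" using assms(3) by (metis abs_le_square_iff abs_of_pos)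
    then show ?thesis using h(3)[OF x] f(1) by fastforce
  qed
  then show False using inverse_in_A(2)[OF h(1), of "\<epsilon>\<^sup>2"] assms(3) h(2) by simp
qed

end

section \<open>Neighbourhoods in the Stone-Cech compactification\<close>

lemma openin_beta_cube_nhd:
  assumes "openin (beta_cube X) W" "z \<in> W"
  shows "\<exists>F \<epsilon>. finite F \<and> F \<subseteq> unit_maps X \<and> 0 < \<epsilon> \<and>
           (\<forall>q\<in>topspace (beta_cube X). (\<forall>f\<in>F. \<bar>q f - z f\<bar> < \<epsilon>) \<longrightarrow> q \<in> W)"
proof -
  let ?I = "unit_maps X"
  obtain U where U: "finite {f \<in> ?I. U f \<noteq> {0..1::real}}"
      "\<And>f. f \<in> ?I \<Longrightarrow> openin (top_of_set {0..1}) (U f)" "z \<in> Pi\<^sub>E ?I U" "Pi\<^sub>E ?I U \<subseteq> W"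
    using assms unfolding beta_cube_def openin_product_topology_alt by auto
  define J where "J = {f \<in> ?I. U f \<noteq> {0..1}}"
  have "\<forall>f\<in>?I. \<exists>e>0. \<forall>t\<in>{0..1}. \<bar>t - z f\<bar> < e \<longrightarrow> t \<in> U f"
  proof
    fix f assume f: "f \<in> ?I"
    then have "z f \<in> U f" using U(3) by auto
    then show "\<exists>e>0. \<forall>t\<in>{0..1}. \<bar>t - z f\<bar> < e \<longrightarrow> t \<in> U f"
      using U(2)[OF f] unfolding openin_euclidean_subtopology_iff by (auto simp: dist_real_def)
  qed
  then obtain e where e: "\<And>f. f \<in> ?I \<Longrightarrow> 0 < e f"
      "\<And>f t. f \<in> ?I \<Longrightarrow> t \<in> {0..1} \<Longrightarrow> \<bar>t - z f\<bar> < e f \<Longrightarrow> t \<in> U f"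
    by metis
  \<comment> \<open>The extra \<open>1\<close> keeps the minimum meaningful when no coordinate is
    constrained.\<close>
  define \<epsilon> where "\<epsilon> = Min (insert 1 (e ` J))"
  have fin: "finite J" using U(1) by (simp add: J_def)
  have \<epsilon>: "0 < \<epsilon>" "\<And>f. f \<in> J \<Longrightarrow> \<epsilon> \<le> e f"
    using fin e(1) by (auto simp: \<epsilon>_def J_def)
  have "q \<in> W" if q: "q \<in> topspace (beta_cube X)" "\<forall>f\<in>J. \<bar>q f - z f\<bar> < \<epsilon>" for q
  proof -
    have qE: "q \<in> (\<Pi>\<^sub>E f\<in>?I. {0..1})" using q(1) by (simp add: beta_cube_def)
    have "q f \<in> U f" if f: "f \<in> ?I" for f
    proof (cases "f \<in> J")
      case True
      then have "\<bar>q f - z f\<bar> < e f" using q(2) \<epsilon>(2) by fastforce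
      then show ?thesis using e(2)[OF f _] PiE_mem[OF qE f] by blast
    next
      case False
      then have "U f = {0..1}" using f by (simp add: J_def)
      then show ?thesis using qE f by auto
    qed
    then have "q \<in> Pi\<^sub>E ?I U" using qE by (auto simp: PiE_iff)
    then show ?thesis using U(4) by blast
  qed
  then show ?thesis using fin \<epsilon>(1) by (intro exI[of _ J] exI[of _ \<epsilon>]) (auto simp: J_def)
qed

lemma openin_betaE:
  assumes "openin (beta X) V"
  obtains W where "openin (beta_cube X) W" "V = topspace (beta X) \<inter> W"
proof -
  obtain W where W: "openin (beta_cube X) W" "V = W \<inter> beta_cube X closure_of (beta_emb X ` topspace X)"
    using assms unfolding beta_def openin_subtopology by blast
  have "topspace (beta X) = beta_cube X closure_of (beta_emb X ` topspace X)"
    by (simp add: beta_def Int_absorb1 closure_of_subset_topspace)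
  then show thesis using that[OF W(1)] W(2) by (simp add: Int_commute)
qed

lemma unit_maps_range:
  assumes "f \<in> unit_maps X" "x \<in> topspace X"
  shows "0 \<le> f x" "f x \<le> 1"
  using assms by (auto simp: unit_maps_def continuous_map_in_subtopology Pi_iff)

context intermediate_character
begin

lemma unit_maps_in_A: "unit_maps X \<subseteq> A"
proof
  fix f assume f: "f \<in> unit_maps X"
  then have fC: "f \<in> carrier (C_ring X)" using unit_maps_subset by blast
  have "\<bar>f x\<bar> \<le> 1" if "x \<in> topspace X" for x
    using unit_maps_range[OF f that] by simp
  then show "f \<in> A" using bounded_in_A[OF C_ring_continuous[OF fC], of 1] C_ring_restrict[OF fC] by simp
qed

text \<open>Basic neighbourhoods in the cube constrain finitely many coordinates up to some
  \<open>\<epsilon>\<close>, so approximating points put the image of \<open>X\<close> into each of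
  them.\<close>

lemma restrict_\<theta>_in_beta: "restrict \<theta> (unit_maps X) \<in> topspace (beta X)"
proof -
  let ?z = "restrict \<theta> (unit_maps X)"
  have "\<theta> f \<in> {0..1}" if f: "f \<in> unit_maps X" for f
  proof -
    have rng: "0 \<le> f x \<and> f x \<le> 1" if "x \<in> topspace X" for x
      using unit_maps_range[OF f that] by simp
    have "- \<epsilon> \<le> \<theta> f \<and> \<theta> f \<le> 1 + \<epsilon>" if "0 < \<epsilon>" for \<epsilon>
      using ex_approximating_point[of "{f}" \<epsilon>] f unit_maps_in_A that rng by force
    then show ?thesis
      using field_le_epsilon[of 0 "\<theta> f"] field_le_epsilon[of "\<theta> f" 1] by fastforce
  qed
  then have "?z \<in> topspace (beta_cube X)" by (auto simp: beta_cube_def)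
  moreover have "\<exists>q\<in>beta_emb X ` topspace X. q \<in> W" if W: "?z \<in> W" "openin (beta_cube X) W" for W
  proof -
    obtain F \<epsilon> where F: "finite F" "F \<subseteq> unit_maps X" "0 < \<epsilon>"
        "\<forall>q\<in>topspace (beta_cube X). (\<forall>f\<in>F. \<bar>q f - ?z f\<bar> < \<epsilon>) \<longrightarrow> q \<in> W"
      using openin_beta_cube_nhd[OF W(2,1)] by blast
    obtain x where x: "x \<in> topspace X" "\<And>f. f \<in> F \<Longrightarrow> \<bar>f x - \<theta> f\<bar> < \<epsilon>"
      using ex_approximating_point[OF F(1) _ F(3)] F(2) unit_maps_in_A by blast
    have "beta_emb X x \<in> topspace (beta_cube X)"
      using x(1) beta_emb_in_beta[of x X] by (simp add: beta_def)
    moreover have "\<bar>beta_emb X x f - ?z f\<bar> < \<epsilon>" if "f \<in> F" for f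
      using x(2)[OF that] that F(2) by (auto simp: beta_emb_def)
    ultimately show ?thesis using F(4) x(1) by blast
  qed
  ultimately show ?thesis
    unfolding beta_def topspace_subtopology by (auto simp: in_closure_of)
qed

text \<open>The point of the compactification given by \<open>\<theta>\<close> either comes from
  \<open>X\<close> or is sent to infinity by the extension of some \<open>f\<close>. The second case
  is spelled out on basic neighbourhoods, so that it can be combined with approximating
  points.\<close>

lemma realcompact_cases:
  assumes "realcompact_space X"
  shows "(\<exists>x\<in>topspace X. \<forall>f\<in>unit_maps X. \<theta> f = f x) \<or>
    (\<exists>f\<in>carrier (C_ring X). \<forall>M. \<exists>F \<epsilon>. finite F \<and> F \<subseteq> unit_maps X \<and> 0 < \<epsilon> \<and>
       (\<forall>x\<in>topspace X. (\<forall>g\<in>F. \<bar>g x - \<theta> g\<bar> < \<epsilon>) \<longrightarrow> M < \<bar>f x\<bar>))"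
proof (cases "restrict \<theta> (unit_maps X) \<in> upsilon X")
  case True
  then obtain x where x: "x \<in> topspace X" "restrict \<theta> (unit_maps X) = beta_emb X x"
    using assms unfolding realcompact_space_def by blast
  have "\<theta> f = f x" if "f \<in> unit_maps X" for f
    using fun_cong[OF x(2), of f] that by (simp add: beta_emb_def)
  then show ?thesis using x(1) by blast
next
  case False
  let ?z = "restrict \<theta> (unit_maps X)" and ?A = "Alexandroff_compactification euclideanreal"
  obtain f where f: "f \<in> carrier (C_ring X)" "beta_ext X f ?z = None"
    using False restrict_\<theta>_in_beta unfolding upsilon_def by blast
  have ext: "is_beta_ext X f (beta_ext X f)"
    unfolding beta_ext_def using ex1_beta_ext[OF f(1)] by (rule theI')
  have "\<exists>F \<epsilon>. finite F \<and> F \<subseteq> unit_maps X \<and> 0 < \<epsilon> \<and>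
       (\<forall>x\<in>topspace X. (\<forall>g\<in>F. \<bar>g x - \<theta> g\<bar> < \<epsilon>) \<longrightarrow> M < \<bar>f x\<bar>)" for M
  proof -
    \<comment> \<open>A basic neighbourhood of infinity: the complement of a compact
      interval.\<close>
    let ?N = "insert None (Some ` (topspace euclideanreal - {- M..M}))"
    have "openin ?A ?N"
      unfolding openin_Alexandroff_compactification by (intro disjI2 exI[of _ "{- M..M}"]) auto
    then have "openin (beta X) {q \<in> topspace (beta X). beta_ext X f q \<in> ?N}"
      using ext unfolding is_beta_ext_def continuous_map_def by blast
    then obtain W where W: "openin (beta_cube X) W"
        "{q \<in> topspace (beta X). beta_ext X f q \<in> ?N} = topspace (beta X) \<inter> W"
      by (rule openin_betaE)
    have zW: "?z \<in> W" using W(2) restrict_\<theta>_in_beta f(2) by auto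
    then obtain F \<epsilon> where F: "finite F" "F \<subseteq> unit_maps X" "0 < \<epsilon>"
        "\<forall>q\<in>topspace (beta_cube X). (\<forall>f\<in>F. \<bar>q f - ?z f\<bar> < \<epsilon>) \<longrightarrow> q \<in> W"
      using openin_beta_cube_nhd[OF W(1) zW] by blast
    have "M < \<bar>f x\<bar>" if x: "x \<in> topspace X" "\<forall>g\<in>F. \<bar>g x - \<theta> g\<bar> < \<epsilon>" for x
    proof -
      have b: "beta_emb X x \<in> topspace (beta X)" using x(1) by (rule beta_emb_in_beta)
      then have "beta_emb X x \<in> topspace (beta_cube X)" by (simp add: beta_def)
      moreover have "\<bar>beta_emb X x g - ?z g\<bar> < \<epsilon>" if "g \<in> F" for g
        using x(2) that F(2) x(1) by (auto simp: beta_emb_def)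
      ultimately have "beta_emb X x \<in> W" using F(4) by blast
      then have "beta_ext X f (beta_emb X x) \<in> ?N" using b W(2) by blast
      then have "Some (f x) \<in> ?N" using ext x(1) unfolding is_beta_ext_def by metis
      then show ?thesis by auto
    qed
    then show ?thesis using F by blast
  qed
  then show ?thesis using f(1) by blast
qed

end

section \<open>Rings of functions convergent along an ultrafilter\<close>

text \<open>Equivalently, the functions whose extension to the Stone-Cech compactification is finite
  at the limit of \<open>s\<close> along \<open>U\<close>.\<close>

definition limit_ring :: "'a topology \<Rightarrow> (nat \<Rightarrow> 'a) \<Rightarrow> nat filter \<Rightarrow> ('a \<Rightarrow> real) set" where
  "limit_ring X s U = {f \<in> carrier (C_ring X). \<exists>l. ((\<lambda>n. f (s n)) \<longlongrightarrow> l) U}"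

text \<open>\<^const>\<open>None\<close> stands for the ideal point, the limit of the sequence along \<open>U\<close>.\<close>

definition pt_eval :: "(nat \<Rightarrow> 'a) \<Rightarrow> nat filter \<Rightarrow> 'a option \<Rightarrow> ('a \<Rightarrow> real) \<Rightarrow> real" where
  "pt_eval s U z f = (case z of None \<Rightarrow> Lim U (\<lambda>n. f (s n)) | Some x \<Rightarrow> f x)"

lemma pt_eval_Some [simp]: "pt_eval s U (Some x) f = f x"
  by (simp add: pt_eval_def)

abbreviation pts :: "'a topology \<Rightarrow> 'a option set" where
  "pts X \<equiv> insert None (Some ` topspace X)"

locale sequence_along_ultrafilter =
  fixes X :: "'a topology" and s :: "nat \<Rightarrow> 'a" and U :: "nat filter"
  assumes s: "\<And>n. s n \<in> topspace X" and U: "ultrafilter U"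
begin

lemma U_nontrivial: "U \<noteq> bot"
  using U by (simp add: ultrafilter_def)

lemma limit_ring_subset: "limit_ring X s U \<subseteq> carrier (C_ring X)"
  by (auto simp: limit_ring_def)

lemma pt_eval_None_eqI: "((\<lambda>n. f (s n)) \<longlongrightarrow> l) U \<Longrightarrow> pt_eval s U None f = l"
  using U_nontrivial by (simp add: pt_eval_def tendsto_Lim)

lemma tendsto_pt_eval: "f \<in> limit_ring X s U \<Longrightarrow> ((\<lambda>n. f (s n)) \<longlongrightarrow> pt_eval s U None f) U"
  using pt_eval_None_eqI by (fastforce simp: limit_ring_def)

lemma limit_ring_tendsto:
  assumes "f \<in> limit_ring X s U" "g \<in> limit_ring X s U"
  shows "((\<lambda>n. (\<lambda>x\<in>topspace X. f x + g x) (s n)) \<longlongrightarrow> pt_eval s U None f + pt_eval s U None g) U"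
    and "((\<lambda>n. (\<lambda>x\<in>topspace X. f x * g x) (s n)) \<longlongrightarrow> pt_eval s U None f * pt_eval s U None g) U"
  using assms[THEN tendsto_pt_eval] s by (simp_all add: tendsto_add tendsto_mult)

lemma intermediate_limit_ring: "intermediate_ring X (limit_ring X s U)"
proof (rule intermediate_ringI)
  show "C_bdd X \<subseteq> limit_ring X s U"
  proof
    fix f assume f: "f \<in> C_bdd X"
    then have "bounded ((\<lambda>n. f (s n)) ` {n. True})"
      unfolding C_bdd_def using s by (auto intro: bounded_subset)
    then show "f \<in> limit_ring X s U"
      using ultrafilter_bounded_tendsto[OF U, of "\<lambda>n. f (s n)" "\<lambda>_. True"] f
      by (simp add: limit_ring_def C_bdd_def)
  qed
  fix f g assume fg: "f \<in> limit_ring X s U" "g \<in> limit_ring X s U"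
  then have c: "continuous_map X euclideanreal f" "continuous_map X euclideanreal g"
    by (auto simp: limit_ring_def C_ring_simps)
  show "(\<lambda>x\<in>topspace X. f x + g x) \<in> limit_ring X s U"
    "(\<lambda>x\<in>topspace X. f x * g x) \<in> limit_ring X s U"
    using limit_ring_tendsto[OF fg] c
    by (auto simp only: limit_ring_def mem_Collect_eq intro!: restrict_in_C_ring continuous_intros)
qed (rule limit_ring_subset)

lemma pt_eval_character:
  assumes "z \<in> pts X"
  shows "character X (limit_ring X s U) (pt_eval s U z)"
proof (cases z)
  case None
  have "((\<lambda>n. (\<lambda>x\<in>topspace X. 1) (s n)) \<longlongrightarrow> 1) U" using s by simp
  then show ?thesis
    unfolding None character_def using limit_ring_tendsto pt_eval_None_eqI by blast
qed (use assms in \<open>auto simp: pt_eval_def character_def\<close>)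

text \<open>The space \<open>Y\<close> consists of the evaluations at the points of \<open>X\<close>
  and at the ideal point, inside a power of the reals. Coordinates turn ring elements into
  continuous functions on \<open>Y\<close>. Conversely, a continuous function on \<open>Y\<close>
  pulls back to \<open>X\<close> with a limit along \<open>U\<close>, namely its value at the ideal
  point.\<close>

lemma C_type_limit_ring: "C_type X (limit_ring X s U)"
proof -
  let ?A = "limit_ring X s U"
  define e where "e z = (\<lambda>f\<in>?A. pt_eval s U z f)" for z
  define P where "P = product_topology (\<lambda>_. euclideanreal) ?A"
  define Y where "Y = subtopology P (e ` pts X)"
  have top_Y: "topspace Y = e ` pts X"
    by (auto simp: Y_def P_def e_def)
  have "Tychonoff_space Y"
    unfolding Tychonoff_space_def Y_def P_def
    by (intro conjI completely_regular_space_subtopology Hausdorff_space_subtopology)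
      (simp_all add: completely_regular_space_product_topology Hausdorff_space_product_topology
        metrizable_imp_completely_regular_space metrizable_space_euclidean)
  have proj: "continuous_map Y euclideanreal (\<lambda>y. y f)" if "f \<in> ?A" for f
    unfolding Y_def P_def using that
    by (intro continuous_map_from_subtopology continuous_map_product_projection)
  have "continuous_map X P (\<lambda>x. e (Some x))"
    unfolding P_def continuous_map_componentwise
    using limit_ring_subset by (auto simp: e_def pt_eval_def C_ring_simps)
  then have e_cont: "continuous_map X Y (\<lambda>x. e (Some x))"
    by (auto simp: Y_def continuous_map_in_subtopology)
  \<comment> \<open>Convergence in the product is coordinatewise, and there it is the defining
    property of the ring.\<close>
  have e_lim: "limitin Y (\<lambda>n. e (Some (s n))) (e None) U"
    unfolding Y_def limitin_subtopology
  proof (intro conjI always_eventually allI)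
    show "limitin P (\<lambda>n. e (Some (s n))) (e None) U"
      unfolding P_def limitin_componentwise
      using s tendsto_pt_eval by (auto simp: e_def pt_eval_def)
  qed (use s in auto)
  define h where "h f = (\<lambda>y\<in>topspace Y. y f)" for f :: "'a \<Rightarrow> real"
  have h_e: "h f (e z) = pt_eval s U z f" if "f \<in> ?A" "z \<in> pts X" for f z
  proof -
    have "e z \<in> topspace Y" unfolding top_Y using that(2) by (rule imageI)
    then have "h f (e z) = e z f" by (simp add: h_def)
    then show ?thesis using that(1) by (simp add: e_def)
  qed
  have C_Y_eqI: "F = G" if "F \<in> carrier (C_ring Y)" "G \<in> carrier (C_ring Y)"
    "\<And>z. z \<in> pts X \<Longrightarrow> F (e z) = G (e z)" for F G
    by (rule C_ring_eqI[OF that(1,2)]) (use that(3) top_Y in auto)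
  have C_Y_ops: "(F \<otimes>\<^bsub>C_ring Y\<^esub> G) (e z) = F (e z) * G (e z)"
    "(F \<oplus>\<^bsub>C_ring Y\<^esub> G) (e z) = F (e z) + G (e z)" "\<one>\<^bsub>C_ring Y\<^esub> (e z) = 1" if "z \<in> pts X" for F G z
  proof -
    have "e z \<in> topspace Y" unfolding top_Y using that by (rule imageI)
    then show "(F \<otimes>\<^bsub>C_ring Y\<^esub> G) (e z) = F (e z) * G (e z)"
      "(F \<oplus>\<^bsub>C_ring Y\<^esub> G) (e z) = F (e z) + G (e z)" "\<one>\<^bsub>C_ring Y\<^esub> (e z) = 1"
      by (simp_all add: C_ring_simps)
  qed
  have char: "pt_eval s U z (\<lambda>x\<in>topspace X. f x + g x) = pt_eval s U z f + pt_eval s U z g"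
     "pt_eval s U z (\<lambda>x\<in>topspace X. f x * g x) = pt_eval s U z f * pt_eval s U z g"
     "pt_eval s U z (\<lambda>x\<in>topspace X. 1) = 1"
    if "f \<in> ?A" "g \<in> ?A" "z \<in> pts X" for f g z
    using pt_eval_character[OF that(3)] that unfolding character_def by auto
  interpret A: subring ?A "C_ring X"
    using intermediate_limit_ring by (simp add: intermediate_ring_def)
  interpret Y: cring "C_ring Y" by (rule cring_C_ring)
  have h_C: "h f \<in> carrier (C_ring Y)" if "f \<in> ?A" for f
    unfolding h_def using that proj by (intro restrict_in_C_ring) auto
  have "h \<in> ring_hom (subring_of_C X ?A) (C_ring Y)"
  proof (rule ring_hom_memI)
    show "h f \<in> carrier (C_ring Y)" if "f \<in> carrier (subring_of_C X ?A)" for f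
      using that h_C by simp
    show "h (f \<otimes>\<^bsub>subring_of_C X ?A\<^esub> g) = h f \<otimes>\<^bsub>C_ring Y\<^esub> h g"
      "h (f \<oplus>\<^bsub>subring_of_C X ?A\<^esub> g) = h f \<oplus>\<^bsub>C_ring Y\<^esub> h g"
      if "f \<in> carrier (subring_of_C X ?A)" "g \<in> carrier (subring_of_C X ?A)" for f g
    proof -
      have fg: "f \<in> ?A" "g \<in> ?A" using that by auto
      have in_A: "(\<lambda>x\<in>topspace X. f x + g x) \<in> ?A" "(\<lambda>x\<in>topspace X. f x * g x) \<in> ?A"
        using A.m_closed[OF fg] subringE(7)[OF A.subring_axioms fg] by (simp_all add: C_ring_simps)
      have "h (\<lambda>x\<in>topspace X. f x * g x) = h f \<otimes>\<^bsub>C_ring Y\<^esub> h g"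
        by (rule C_Y_eqI) (simp_all only: h_C in_A fg Y.m_closed h_e C_Y_ops char)
      moreover have "h (\<lambda>x\<in>topspace X. f x + g x) = h f \<oplus>\<^bsub>C_ring Y\<^esub> h g"
        by (rule C_Y_eqI) (simp_all only: h_C in_A fg Y.a_closed h_e C_Y_ops char)
      ultimately show "h (f \<otimes>\<^bsub>subring_of_C X ?A\<^esub> g) = h f \<otimes>\<^bsub>C_ring Y\<^esub> h g"
        "h (f \<oplus>\<^bsub>subring_of_C X ?A\<^esub> g) = h f \<oplus>\<^bsub>C_ring Y\<^esub> h g"
        by (simp_all add: C_ring_simps)
    qed
    have one: "(\<lambda>x\<in>topspace X. 1) \<in> ?A" using A.one_closed by (simp add: C_ring_simps)
    have "h (\<lambda>x\<in>topspace X. 1) = \<one>\<^bsub>C_ring Y\<^esub>"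
      by (rule C_Y_eqI) (simp_all only: h_C one Y.one_closed h_e C_Y_ops char(3)[OF one one])
    then show "h \<one>\<^bsub>subring_of_C X ?A\<^esub> = \<one>\<^bsub>C_ring Y\<^esub>" by (simp add: C_ring_simps)
  qed
  moreover have "bij_betw h ?A (carrier (C_ring Y))"
    unfolding bij_betw_def
  proof
    show "inj_on h ?A"
    proof (rule inj_onI)
      fix f g assume fg: "f \<in> ?A" "g \<in> ?A" "h f = h g"
      have "f x = g x" if "x \<in> topspace X" for x
        using h_e[OF fg(1), of "Some x"] h_e[OF fg(2), of "Some x"] that fg(3) by (simp add: pt_eval_def)
      then show "f = g"
        by (rule C_ring_eqI[OF subsetD[OF limit_ring_subset fg(1)] subsetD[OF limit_ring_subset fg(2)]])
    qed
    have "\<exists>f\<in>?A. h f = g" if g: "g \<in> carrier (C_ring Y)" for g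
    proof -
      have gc: "continuous_map Y euclideanreal g" using g by (rule C_ring_continuous)
      define f where "f = (\<lambda>x\<in>topspace X. g (e (Some x)))"
      have "continuous_map X euclideanreal (\<lambda>x. g (e (Some x)))"
        using continuous_map_compose[OF e_cont gc] by (simp add: o_def)
      then have "f \<in> carrier (C_ring X)" unfolding f_def by (rule restrict_in_C_ring)
      moreover have lim: "((\<lambda>n. f (s n)) \<longlongrightarrow> g (e None)) U"
        using continuous_map_limit[OF gc e_lim] s by (simp add: o_def f_def)
      ultimately have f: "f \<in> ?A" unfolding limit_ring_def by blast
      have "h f (e z) = g (e z)" if "z \<in> pts X" for z
      proof (cases z)
        case None
        then show ?thesis using h_e[OF f that] pt_eval_None_eqI[OF lim] by simp
      next
        case (Some x)
        then have "x \<in> topspace X" using that by blast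
        then show ?thesis using h_e[OF f that] Some by (simp add: f_def)
      qed
      then have "h f = g" using C_Y_eqI[OF h_C[OF f] g] by blast
      then show ?thesis using f by blast
    qed
    moreover have "h ` ?A \<subseteq> carrier (C_ring Y)"
      using h_C by blast
    ultimately show "h ` ?A = carrier (C_ring Y)" by blast
  qed
  ultimately have "subring_of_C X ?A \<simeq> C_ring Y"
    unfolding is_ring_iso_def ring_iso_def by auto
  then show ?thesis using \<open>Tychonoff_space Y\<close> by (rule C_typeI[rotated])
qed

text \<open>The character is first identified on \<open>unit_maps X\<close>, where realcompactness
  applies, and then on the whole ring.\<close>

lemma character_eq_pt_eval:
  assumes "realcompact_space X" and \<theta>: "character X (limit_ring X s U) \<theta>"
  shows "\<exists>z\<in>pts X. \<forall>f\<in>limit_ring X s U. \<theta> f = pt_eval s U z f"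
proof -
  let ?A = "limit_ring X s U" and ?l = "pt_eval s U None"
  interpret intermediate_character X ?A \<theta>
    by unfold_locales (use intermediate_limit_ring \<theta> in auto)
  have "\<exists>z\<in>pts X. \<forall>f\<in>unit_maps X. \<theta> f = pt_eval s U z f"
  proof (rule ccontr)
    assume no: "\<not> ?thesis"
    have "\<not> (\<exists>x\<in>topspace X. \<forall>f\<in>unit_maps X. \<theta> f = f x)"
    proof
      assume "\<exists>x\<in>topspace X. \<forall>f\<in>unit_maps X. \<theta> f = f x"
      then obtain x where "x \<in> topspace X" "\<forall>f\<in>unit_maps X. \<theta> f = f x" by blast
      then have "Some x \<in> pts X \<and> (\<forall>f\<in>unit_maps X. \<theta> f = pt_eval s U (Some x) f)"
        by (simp add: pt_eval_def)
      then show False using no by blast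
    qed
    then obtain f where f: "f \<in> carrier (C_ring X)"
      and f_large: "\<And>M. \<exists>F \<epsilon>. finite F \<and> F \<subseteq> unit_maps X \<and> 0 < \<epsilon> \<and>
           (\<forall>x\<in>topspace X. (\<forall>g\<in>F. \<bar>g x - \<theta> g\<bar> < \<epsilon>) \<longrightarrow> M < \<bar>f x\<bar>)"
      using realcompact_cases[OF assms(1)] by blast
    \<comment> \<open>The function \<open>f\<close> is large near the point of
      \<open>\<theta>\<close> but may lie outside the ring. A unit map \<open>u\<close> separating
      that point from the ideal one gives a factor \<open>v\<close> that vanishes near the ideal
      point and is at least \<open>d / 4\<close> near the point of \<open>\<theta>\<close>. Hence
      \<open>h\<close> lies in the ring and is still large there, so its reciprocal is nearly 0,
      although \<open>\<theta>\<close> of an inverse cannot be 0.\<close>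
    obtain u where u: "u \<in> unit_maps X" "\<theta> u \<noteq> ?l u"
      using no by blast
    define d where "d = \<bar>\<theta> u - ?l u\<bar>"
    have d: "0 < d" using u(2) by (simp add: d_def)
    define v where "v x = max 0 (\<bar>u x - ?l u\<bar> - d / 2)" for x
    define h where "h = (\<lambda>x\<in>topspace X. 1 + (f x * v x)\<^sup>2)"
    have uA: "u \<in> ?A" using u(1) unit_maps_in_A by blast
    have uc: "continuous_map X euclideanreal u" using uA A_subset C_ring_continuous by blast
    have "continuous_map X euclideanreal (\<lambda>x. 1 + (f x * v x)\<^sup>2)"
      unfolding v_def using uc C_ring_continuous[OF f] by (intro continuous_intros) auto
    then have hC: "h \<in> carrier (C_ring X)" unfolding h_def by (rule restrict_in_C_ring)
    have "eventually (\<lambda>n. dist (u (s n)) (?l u) < d / 2) U"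
      using tendsto_pt_eval[OF uA] d by (intro tendstoD) auto
    then have "eventually (\<lambda>n. h (s n) = 1) U"
      by (rule eventually_mono) (use s in \<open>simp add: h_def v_def dist_real_def\<close>)
    then have "((\<lambda>n. h (s n)) \<longlongrightarrow> 1) U" by (rule tendsto_eventually)
    then have hA: "h \<in> ?A" using hC by (auto simp: limit_ring_def)
    define k where "k = (\<lambda>x\<in>topspace X. 1 / h x)"
    have k: "k \<in> ?A" "\<theta> h * \<theta> k = 1"
      using inverse_in_A[OF hA, of 1] by (simp_all add: k_def h_def)
    define r where "r = \<bar>\<theta> k\<bar>"
    have r: "0 < r" using k(2) by (auto simp: r_def)
    \<comment> \<open>Chosen so that \<open>M * (d / 4) = sqrt (2 / r)\<close>, which forces
      \<open>h x > 2 / r\<close> and \<open>k x < r / 2\<close>.\<close>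
    define M where "M = 4 / d * sqrt (2 / r)"
    obtain F \<epsilon> where F: "finite F" "F \<subseteq> unit_maps X" "0 < \<epsilon>"
        "\<And>x. x \<in> topspace X \<Longrightarrow> \<forall>g\<in>F. \<bar>g x - \<theta> g\<bar> < \<epsilon> \<Longrightarrow> M < \<bar>f x\<bar>"
      using f_large[of M] by blast
    define \<delta> where "\<delta> = min \<epsilon> (min (d / 4) (r / 2))"
    have \<delta>: "0 < \<delta>" "\<delta> \<le> \<epsilon>" "\<delta> \<le> d / 4" "\<delta> \<le> r / 2" using F(3) d r by (auto simp: \<delta>_def)
    obtain x where x: "x \<in> topspace X" "\<And>g. g \<in> insert u (insert k F) \<Longrightarrow> \<bar>g x - \<theta> g\<bar> < \<delta>"
      using ex_approximating_point[of "insert u (insert k F)" \<delta>] F(1,2) k(1) uA unit_maps_in_A \<delta>(1) by blast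
    have "M < \<bar>f x\<bar>" using x(2) \<delta>(2) by (intro F(4)[OF x(1)]) force
    moreover have "d / 4 \<le> v x"
    proof -
      have "\<bar>u x - \<theta> u\<bar> < d / 4" using x(2)[of u] \<delta>(3) by simp
      moreover have "d \<le> \<bar>u x - \<theta> u\<bar> + \<bar>u x - ?l u\<bar>" unfolding d_def by arith
      ultimately have "3 * d / 4 \<le> \<bar>u x - ?l u\<bar>" by simp
      then show ?thesis unfolding v_def using d by linarith
    qed
    ultimately have "M * (d / 4) \<le> \<bar>f x\<bar> * v x"
      using d by (intro mult_mono) auto
    also have "\<dots> = \<bar>f x * v x\<bar>" by (simp add: abs_mult v_def)
    finally have "M * (d / 4) \<le> \<bar>f x * v x\<bar>" .
    then have "sqrt (2 / r) \<le> \<bar>f x * v x\<bar>" using d by (simp add: M_def)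
    then have "(sqrt (2 / r))\<^sup>2 \<le> \<bar>f x * v x\<bar>\<^sup>2" using r by (intro power_mono) auto
    then have "2 / r \<le> (f x * v x)\<^sup>2" using r by simp
    then have "2 / r < h x" using x(1) by (simp add: h_def)
    moreover have "0 < h x" using x(1) by (simp add: h_def add_pos_nonneg)
    ultimately have "1 / h x < r / 2" using r by (simp add: field_simps)
    then have "k x < r / 2" using x(1) by (simp add: k_def)
    moreover have "0 \<le> k x" using x(1) by (simp add: k_def h_def)
    moreover have "\<bar>k x - \<theta> k\<bar> < r / 2" using x(2)[of k] \<delta>(4) by simp
    ultimately show False by (auto simp: r_def abs_if split: if_splits)
  qed
  then obtain z where z: "z \<in> pts X" "\<And>f. f \<in> unit_maps X \<Longrightarrow> \<theta> f = pt_eval s U z f" by blast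
  have "\<theta> f = pt_eval s U z f" if f: "f \<in> ?A" for f
  proof -
    \<comment> \<open>The unit map \<open>k = 1 / (1 + (f - \<theta> f)\<^sup>2)\<close> has
      \<open>\<theta> k = 1\<close>. Agreement at \<open>z\<close> on \<open>k\<close> then forces
      \<open>f\<close> to have value \<open>\<theta> f\<close> there.\<close>
    define h where "h = (\<lambda>x\<in>topspace X. (f x - \<theta> f)\<^sup>2 + (\<lambda>x\<in>topspace X. 1) x)"
    define k where "k = (\<lambda>x\<in>topspace X. 1 / h x)"
    have sq: "(\<lambda>x\<in>topspace X. (f x - \<theta> f)\<^sup>2) \<in> ?A" "\<theta> (\<lambda>x\<in>topspace X. (f x - \<theta> f)\<^sup>2) = 0"
      using square_diff[OF f, of "\<theta> f"] by auto
    have h_eq: "h = (\<lambda>x\<in>topspace X. (\<lambda>x\<in>topspace X. (f x - \<theta> f)\<^sup>2) x + (\<lambda>x\<in>topspace X. 1) x)"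
      unfolding h_def by (rule restrict_ext) simp
    have h: "h \<in> ?A" "\<theta> h = 1"
      unfolding h_eq using add_in_A[OF sq(1) const_in_A] \<theta>_add[OF sq(1) const_in_A] sq(2) \<theta>_const by auto
    have k: "k \<in> ?A" "\<theta> h * \<theta> k = 1"
      using inverse_in_A[OF h(1), of 1] by (simp_all add: k_def h_def)
    have hx: "h x = 1 + (f x - \<theta> f)\<^sup>2" if "x \<in> topspace X" for x using that by (simp add: h_def)
    have "k x \<in> {0..1}" if "x \<in> topspace X" for x
      using that hx[OF that] by (simp add: k_def divide_le_eq_1 add_pos_nonneg)
    then have "k \<in> unit_maps X"
      using k(1) A_subset by (auto simp: unit_maps_def C_ring_simps continuous_map_in_subtopology)
    then have kz: "pt_eval s U z k = 1" using z(2) k(2) h(2) by simp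
    show ?thesis
    proof (cases z)
      case (Some x)
      then show ?thesis using z(1) kz hx[of x] by (auto simp: pt_eval_def k_def)
    next
      case None
      have nz: "1 + (?l f - \<theta> f)\<^sup>2 \<noteq> 0" by (smt (verit) zero_le_power2)
      have "((\<lambda>n. 1 / (1 + (f (s n) - \<theta> f)\<^sup>2)) \<longlongrightarrow> 1 / (1 + (?l f - \<theta> f)\<^sup>2)) U"
        by (intro tendsto_intros tendsto_pt_eval f nz)
      then have "((\<lambda>n. k (s n)) \<longlongrightarrow> 1 / (1 + (?l f - \<theta> f)\<^sup>2)) U"
        using s hx by (simp add: k_def)
      then have "1 / (1 + (?l f - \<theta> f)\<^sup>2) = 1" using kz None pt_eval_None_eqI by metis
      then show ?thesis using None nz by (simp add: field_simps)
    qed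
  qed
  then show ?thesis using z(1) by blast
qed

end

section \<open>Zero sets and discrete sequences\<close>

text \<open>The Weierstrass M-test gives uniform convergence, which preserves continuity.\<close>

lemma continuous_map_geometric_suminf:
  fixes f :: "nat \<Rightarrow> 'a \<Rightarrow> real"
  assumes cont: "\<And>n. continuous_map X euclideanreal (f n)"
    and bnd: "\<And>n x. x \<in> topspace X \<Longrightarrow> \<bar>f n x\<bar> \<le> 1"
  shows "continuous_map X euclideanreal (\<lambda>x. \<Sum>n. (1 / 2) ^ n * f n x)"
proof -
  have "uniform_limit (topspace X) (\<lambda>N x. \<Sum>n<N. (1 / 2) ^ n * f n x) (\<lambda>x. \<Sum>n. (1 / 2) ^ n * f n x) sequentially"
    by (rule Weierstrass_m_test[where M = "\<lambda>n. (1 / 2) ^ n"])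
      (use bnd in \<open>auto simp: abs_mult power_abs mult_left_le\<close>)
  then have lim: "\<forall>\<^sub>F N in sequentially. \<forall>x\<in>topspace X.
      dist (\<Sum>n<N. (1 / 2) ^ n * f n x) (\<Sum>n. (1 / 2) ^ n * f n x) < \<epsilon>" if "0 < \<epsilon>" for \<epsilon>
    using that unfolding uniform_limit_iff by blast
  have "continuous_map X Met_TC.mtopology (\<lambda>x. \<Sum>n. (1 / 2) ^ n * f n x)"
  proof (rule Met_TC.continuous_map_uniform_limit)
    have "continuous_map X euclideanreal (\<lambda>x. \<Sum>n<N. (1 / 2) ^ n * f n x)" for N
      by (intro continuous_map_sum continuous_map_real_mult cont) auto
    then show "\<forall>\<^sub>F N in sequentially. continuous_map X Met_TC.mtopology (\<lambda>x. \<Sum>n<N. (1 / 2) ^ n * f n x)"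
      by simp
  qed (use lim in simp_all)
  then show ?thesis by simp
qed

lemma geometric_suminf_bounds:
  fixes a :: "nat \<Rightarrow> real"
  assumes "\<And>n. 0 \<le> a n" "\<And>n. a n \<le> 1"
  shows "0 \<le> (\<Sum>n. (1 / 2) ^ n * a n)" "(\<Sum>n. (1 / 2) ^ n * a n) \<le> 2"
    and "(\<Sum>n. (1 / 2) ^ n * a n) = 0 \<longleftrightarrow> (\<forall>n. a n = 0)"
proof -
  have sm: "summable (\<lambda>n. (1 / 2) ^ n * a n)"
    by (rule summable_comparison_test'[of "\<lambda>n. (1 / 2) ^ n"]) (use assms in \<open>auto simp: mult_left_le\<close>)
  show "0 \<le> (\<Sum>n. (1 / 2) ^ n * a n)" using sm assms by (intro suminf_nonneg) auto
  have "(\<Sum>n. (1 / 2) ^ n * a n) \<le> (\<Sum>n. (1 / 2) ^ n)"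
    by (intro suminf_le sm) (use assms in \<open>auto simp: mult_left_le\<close>)
  then show "(\<Sum>n. (1 / 2) ^ n * a n) \<le> 2" by (simp add: suminf_geometric)
  show "(\<Sum>n. (1 / 2) ^ n * a n) = 0 \<longleftrightarrow> (\<forall>n. a n = 0)"
    using suminf_eq_zero_iff[OF sm] assms by simp
qed

lemma continuous_map_infdist:
  fixes u :: "'a \<Rightarrow> 'b::metric_space"
  assumes "continuous_map X euclidean u"
  shows "continuous_map X euclideanreal (\<lambda>x. infdist (u x) S)"
proof -
  have "continuous_map euclidean euclideanreal (\<lambda>t :: 'b. infdist t S)"
    by (simp add: continuous_on_infdist)
  from continuous_map_compose[OF assms this] show ?thesis by (simp add: o_def)
qed

lemma le_infdistI: "S \<noteq> {} \<Longrightarrow> (\<And>y. y \<in> S \<Longrightarrow> d \<le> dist x y) \<Longrightarrow> d \<le> infdist x S"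
  by (simp add: infdist_notempty cINF_greatest)

lemma Tychonoff_bump:
  assumes "Tychonoff_space X" "openin X V" "x \<in> V"
  obtains h where "continuous_map X euclideanreal h" "\<And>y. y \<in> topspace X \<Longrightarrow> 0 \<le> h y"
    "\<And>y. y \<in> topspace X \<Longrightarrow> h y \<le> 1" "h x = 1" "\<And>y. y \<in> topspace X - V \<Longrightarrow> h y = 0"
proof -
  have "closedin X (topspace X - V)" "x \<in> topspace X - (topspace X - V)"
    using assms openin_subset by auto
  then obtain f where f: "continuous_map X (top_of_set {0..1::real}) f" "f x = 0" "f ` (topspace X - V) \<subseteq> {1}"
    using assms(1) unfolding Tychonoff_space_def completely_regular_space_def image_subset_iff_funcset
    by blast
  then have "continuous_map X euclideanreal f" "f \<in> topspace X \<rightarrow> {0..1}"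
    by (auto simp: continuous_map_in_subtopology)
  then show thesis
    using f by (intro that[of "\<lambda>y. 1 - f y"]) (auto intro!: continuous_intros simp: Pi_iff image_subset_iff)
qed

section \<open>Countable neighbourhood bases and zero sets\<close>

lemma first_countable_base_sequence:
  assumes "first_countable X" "x \<in> topspace X"
  shows "\<exists>B :: nat \<Rightarrow> 'a set. (\<forall>k. openin X (B k) \<and> x \<in> B k) \<and>
    (\<forall>V. openin X V \<longrightarrow> x \<in> V \<longrightarrow> (\<exists>k. B k \<subseteq> V))"
proof -
  obtain \<B> where \<B>: "countable \<B>" "\<And>V. V \<in> \<B> \<Longrightarrow> openin X V"
      "\<And>V. openin X V \<Longrightarrow> x \<in> V \<Longrightarrow> \<exists>W\<in>\<B>. x \<in> W \<and> W \<subseteq> V"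
    using assms unfolding first_countable_def by metis
  let ?C = "{V \<in> \<B>. x \<in> V}"
  have C: "countable ?C" "?C \<noteq> {}"
    using countable_subset[OF _ \<B>(1), of ?C] \<B>(3)[OF openin_topspace assms(2)] by auto
  show ?thesis
  proof (rule exI[of _ "from_nat_into ?C"], intro conjI allI impI)
    fix k
    show "openin X (from_nat_into ?C k)" "x \<in> from_nat_into ?C k"
      using from_nat_into[OF C(2), of k] \<B>(2) by auto
  next
    fix V assume "openin X V" "x \<in> V"
    then obtain W where W: "W \<in> ?C" "W \<subseteq> V" using \<B>(3) by blast
    obtain k where "from_nat_into ?C k = W" using from_nat_into_surj[OF C(1) W(1)] by blast
    then show "\<exists>k. from_nat_into ?C k \<subseteq> V" using W(2) by blast
  qed
qed

text \<open>Bumps \<open>h k\<close> supported in the members of a countable base at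
  \<open>x\<close> are summed as \<open>1 - h k\<close> with geometric weights. The sum vanishes
  only in the intersection of the base, which is \<open>{x}\<close>; halving brings the bound 2 down
  to 1.\<close>

lemma first_countable_point_zero_set:
  assumes "Tychonoff_space X" "first_countable X" "x \<in> topspace X"
  obtains g where "continuous_map X euclideanreal g" "\<And>y. y \<in> topspace X \<Longrightarrow> 0 \<le> g y"
    "\<And>y. y \<in> topspace X \<Longrightarrow> g y \<le> 1" "\<And>y. y \<in> topspace X \<Longrightarrow> g y = 0 \<longleftrightarrow> y = x"
proof -
  obtain B where "\<forall>k. openin X (B k) \<and> x \<in> B k"
      "\<forall>V. openin X V \<longrightarrow> x \<in> V \<longrightarrow> (\<exists>k::nat. B k \<subseteq> V)"
    using first_countable_base_sequence[OF assms(2,3)] by blast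
  then have B: "openin X (B k)" "x \<in> B k" "openin X V \<Longrightarrow> x \<in> V \<Longrightarrow> \<exists>k. B k \<subseteq> V" for k V
    by auto
  have "\<exists>h. continuous_map X euclideanreal h \<and> (\<forall>y\<in>topspace X. 0 \<le> h y \<and> h y \<le> 1) \<and> h x = 1 \<and>
      (\<forall>y\<in>topspace X - B k. h y = 0)" for k
    by (rule Tychonoff_bump[OF assms(1) B(1,2), of k]) blast
  then obtain h where h: "\<And>k. continuous_map X euclideanreal (h k)"
      "\<And>k y. y \<in> topspace X \<Longrightarrow> 0 \<le> h k y" "\<And>k y. y \<in> topspace X \<Longrightarrow> h k y \<le> 1" "\<And>k. h k x = 1"
      "\<And>k y. y \<in> topspace X - B k \<Longrightarrow> h k y = 0"
    by metis
  define G where "G y = (\<Sum>k. (1 / 2) ^ k * (1 - h k y))" for y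
  have Gb: "0 \<le> G y" "G y \<le> 2" "G y = 0 \<longleftrightarrow> (\<forall>k. h k y = 1)" if "y \<in> topspace X" for y
    using geometric_suminf_bounds[of "\<lambda>k. 1 - h k y"] h(2,3)[OF that] by (simp_all add: G_def)
  have "continuous_map X euclideanreal G"
    unfolding G_def by (rule continuous_map_geometric_suminf)
      (use h in \<open>auto intro!: continuous_intros simp: abs_le_iff\<close>)
  moreover have "G y = 0 \<longleftrightarrow> y = x" if y: "y \<in> topspace X" for y
  proof
    assume "G y = 0"
    then have "h k y = 1" for k using Gb(3)[OF y] by blast
    then have inB: "y \<in> B k" for k using h(5)[of y k] y by force
    show "y = x"
    proof (rule ccontr)
      assume "y \<noteq> x"
      have "t1_space X" using assms(1) by (simp add: Tychonoff_space_def Hausdorff_imp_t1_space)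
      then have "openin X (topspace X - {y})" using y by (simp add: closedin_t1_singleton openin_diff)
      then obtain k where "B k \<subseteq> topspace X - {y}" using B(3) \<open>y \<noteq> x\<close> assms(3) by blast
      then show False using inB by blast
    qed
  qed (use Gb(3)[OF y] h(4) in simp)
  ultimately show thesis
    using Gb by (intro that[of "\<lambda>y. G y / 2"]) (auto intro!: continuous_intros)
qed

text \<open>A strictly increasing choice visits each \<open>S k\<close> at the two steps
  \<open>2 * k\<close> and \<open>2 * k + 1\<close>; even and odd steps give the two sets.\<close>

lemma disjoint_transversals:
  fixes S :: "nat \<Rightarrow> nat set"
  assumes "\<And>k. infinite (S k)"
  obtains T T' where "T \<inter> T' = {}" "\<And>k. T \<inter> S k \<noteq> {}" "\<And>k. T' \<inter> S k \<noteq> {}"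
proof -
  have "\<exists>m. \<forall>j. m j \<in> S (j div 2) \<and> m j < m (Suc j)"
  proof (rule dependent_nat_choice)
    show "\<exists>x. x \<in> S (0 div 2)" using assms[of 0] by (metis div_0 finite.emptyI equals0I)
    show "\<exists>y. y \<in> S (Suc j div 2) \<and> x < y" for x j
      using assms[of "Suc j div 2"] unfolding infinite_nat_iff_unbounded by blast
  qed
  then obtain m where m: "\<And>j. m j \<in> S (j div 2)" "strict_mono m"
    by (auto simp: strict_mono_Suc_iff)
  show thesis
  proof (rule that[of "m ` {j. even j}" "m ` {j. odd j}"])
    show "m ` {j. even j} \<inter> m ` {j. odd j} = {}"
      using strict_mono_imp_inj_on[OF m(2)] by (subst image_Int[symmetric]) auto
    fix k
    have "m (2 * k) \<in> m ` {j. even j} \<inter> S k"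
      using m(1)[of "2 * k"] by simp
    then show "m ` {j. even j} \<inter> S k \<noteq> {}" by fastforce
    have "m (2 * k + 1) \<in> m ` {j. odd j} \<inter> S k"
      using m(1)[of "2 * k + 1"] by simp
    then show "m ` {j. odd j} \<inter> S k \<noteq> {}" by fastforce
  qed
qed

lemma infinite_if_eventually_sequentially:
  assumes "F \<le> sequentially" "F \<noteq> bot" "eventually P F"
  shows "infinite {n. P n}"
proof
  assume "finite {n. P n}"
  then have "eventually (\<lambda>n. \<not> P n) sequentially"
    unfolding cofinite_eq_sequentially[symmetric] by (simp add: eventually_cofinite)
  then have "eventually (\<lambda>n. P n \<and> \<not> P n) F"
    using assms(1,3) filter_leD eventually_conj by blast
  then show False using assms(2) by (simp add: eventually_False)
qed

text \<open>The gap 2 makes the sets where \<open>u\<close> is within 1 of \<open>u (s n)\<close>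
  pairwise disjoint, and drives \<open>u (s n)\<close> to infinity.\<close>

locale unbounded_sequence =
  fixes X :: "'a topology" and u :: "'a \<Rightarrow> real" and s :: "nat \<Rightarrow> 'a"
  assumes Tychonoff: "Tychonoff_space X" and first_countable: "first_countable X"
    and realcompact: "realcompact_space X"
    and u: "continuous_map X euclideanreal u"
    and s: "\<And>n. s n \<in> topspace X"
    and gap: "\<And>n. u (s n) + 2 \<le> u (s (Suc n))"
begin

lemma gap_less: "m < n \<Longrightarrow> u (s m) + 2 \<le> u (s n)"
proof (induction n)
  case (Suc n)
  then show ?case using gap[of n] by (cases "m = n") auto
qed simp

lemma gap_neq: "m \<noteq> n \<Longrightarrow> 2 \<le> \<bar>u (s m) - u (s n)\<bar>"
  using gap_less[of m n] gap_less[of n m] by (cases m n rule: linorder_cases) auto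

lemma u_lower: "u (s 0) + 2 * real n \<le> u (s n)"
  by (induction n) (use gap in \<open>auto intro: order_trans[OF _ gap]\<close>)

lemma ex_indicator: "\<exists>f\<in>C_bdd X. \<forall>n. f (s n) = of_bool (n \<in> S)"
proof (cases "S = {}")
  case True
  then show ?thesis
    using restrict_in_C_bdd[of X "\<lambda>_. 0" 0] s by (intro bexI[of _ "\<lambda>x\<in>topspace X. 0"]) auto
next
  case False
  let ?D = "(\<lambda>n. u (s n)) ` S"
  let ?f = "\<lambda>x. max 0 (1 - infdist (u x) ?D)"
  have "(\<lambda>x\<in>topspace X. ?f x) \<in> C_bdd X"
    by (rule restrict_in_C_bdd[where B = 1])
      (auto intro!: continuous_intros continuous_map_infdist u simp: infdist_nonneg)
  moreover have "?f (s n) = of_bool (n \<in> S)" for n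
  proof (cases "n \<in> S")
    case True
    then have "infdist (u (s n)) ?D = 0" by (intro infdist_zero) auto
    then show ?thesis using True by simp
  next
    case n: False
    have "2 \<le> infdist (u (s n)) ?D"
    proof (rule le_infdistI)
      fix y assume "y \<in> ?D"
      then obtain m where "m \<in> S" "y = u (s m)" by blast
      then show "2 \<le> dist (u (s n)) y" using gap_neq[of n m] n by (auto simp: dist_real_def)
    qed (use False in simp)
    then show ?thesis using n by simp
  qed
  ultimately show ?thesis using s by (intro bexI[of _ "\<lambda>x\<in>topspace X. ?f x"]) simp_all
qed

text \<open>The distance term vanishes only if \<open>u x\<close> is close to some
  \<open>u (s m)\<close> with \<open>m \<in> S\<close>. There the bump \<open>b m\<close> is
  positive, so vanishing of \<open>G\<close> forces \<open>g m x = 0\<close>, that is,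
  \<open>x = s m\<close>. Disjointness of the bumps makes \<open>G\<close> vanish at every
  \<open>s n\<close>.\<close>

lemma ex_zero_set: "\<exists>f\<in>C_bdd X. \<forall>x\<in>topspace X. 0 \<le> f x \<and> (f x = 0 \<longleftrightarrow> x \<in> s ` S)"
proof (cases "S = {}")
  case True
  then show ?thesis
    using restrict_in_C_bdd[of X "\<lambda>_. 1" 1] by (intro bexI[of _ "\<lambda>x\<in>topspace X. 1"]) auto
next
  case False
  have "\<exists>g. continuous_map X euclideanreal g \<and> (\<forall>y\<in>topspace X. 0 \<le> g y \<and> g y \<le> 1 \<and> (g y = 0 \<longleftrightarrow> y = s n))" for n
    using first_countable_point_zero_set[OF Tychonoff first_countable s[of n]] by metis
  then obtain g where g: "\<And>n. continuous_map X euclideanreal (g n)"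
      "\<And>n y. y \<in> topspace X \<Longrightarrow> 0 \<le> g n y" "\<And>n y. y \<in> topspace X \<Longrightarrow> g n y \<le> 1"
      "\<And>n y. y \<in> topspace X \<Longrightarrow> g n y = 0 \<longleftrightarrow> y = s n"
    by metis
  let ?D = "(\<lambda>n. u (s n)) ` S"
  define b where "b n x = max 0 (1 - \<bar>u x - u (s n)\<bar>)" for n x
  have b: "0 \<le> b n x" "b n x \<le> 1" for n x by (auto simp: b_def)
  have bg: "0 \<le> b n x * g n x" "b n x * g n x \<le> 1" if "x \<in> topspace X" for n x
    using b[of n x] g(2,3)[OF that, of n] by (auto intro: mult_le_one)
  define G where "G x = (\<Sum>n. (1 / 2) ^ n * (b n x * g n x))" for x
  have G: "0 \<le> G x" "G x \<le> 2" "G x = 0 \<longleftrightarrow> (\<forall>n. b n x * g n x = 0)" if "x \<in> topspace X" for x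
    unfolding G_def using geometric_suminf_bounds[of "\<lambda>n. b n x * g n x", OF bg[OF that]] by auto
  have G_cont: "continuous_map X euclideanreal G"
    unfolding G_def by (rule continuous_map_geometric_suminf)
      (use g(1) u bg in \<open>auto simp: b_def[abs_def] abs_le_iff intro!: continuous_intros intro: order_trans[of _ 0]\<close>)
  let ?f = "\<lambda>x. min 1 (infdist (u x) ?D) + G x"
  have "(\<lambda>x\<in>topspace X. ?f x) \<in> C_bdd X"
  proof (rule restrict_in_C_bdd[where B = 3])
    show "continuous_map X euclideanreal ?f"
      by (intro continuous_intros continuous_map_infdist u G_cont)
    show "\<bar>?f x\<bar> \<le> 3" if "x \<in> topspace X" for x
      using G(1,2)[OF that] infdist_nonneg[of "u x" ?D] by linarith
  qed
  moreover have "0 \<le> ?f x \<and> (?f x = 0 \<longleftrightarrow> x \<in> s ` S)" if x: "x \<in> topspace X" for x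
  proof (intro conjI iffI)
    show "0 \<le> ?f x" using G(1)[OF x] infdist_nonneg[of "u x" ?D] by linarith
  next
    assume "?f x = 0"
    then have 0: "infdist (u x) ?D = 0" "G x = 0"
      using G(1)[OF x] infdist_nonneg[of "u x" ?D] by linarith+
    have "\<not> 1 / 2 \<le> infdist (u x) ?D" using 0 by simp
    then obtain m where m: "m \<in> S" "\<bar>u x - u (s m)\<bar> < 1 / 2"
      using le_infdistI[of ?D "1 / 2" "u x"] False by (force simp: dist_real_def)
    then have "b m x \<noteq> 0" by (simp add: b_def)
    moreover have "b m x * g m x = 0" using 0(2) G(3)[OF x] by blast
    ultimately have "x = s m" using g(4)[OF x] by simp
    then show "x \<in> s ` S" using m(1) by simp
  next
    assume "x \<in> s ` S"
    then obtain m where m: "m \<in> S" "x = s m" by blast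
    have "b n x * g n x = 0" for n
    proof (cases "n = m")
      case True
      then show ?thesis using g(4)[OF x, of m] m(2) by simp
    next
      case False
      then show ?thesis using gap_neq[of m n] m(2) by (simp add: b_def)
    qed
    then have "G x = 0" using G(3)[OF x] by blast
    moreover have "infdist (u x) ?D = 0" using m by (intro infdist_zero) auto
    ultimately show "?f x = 0" by simp
  qed
  ultimately show ?thesis by (intro bexI[of _ "\<lambda>x\<in>topspace X. ?f x"]) simp_all
qed

text \<open>Separates a point of \<open>X\<close> from the ideal point of any free ultrafilter,
  because \<open>u\<close> tends to infinity along \<open>s\<close>.\<close>

lemma ex_vanishing_at_point:
  assumes "x \<in> topspace X"
  shows "\<exists>f\<in>C_bdd X. f x = 0 \<and> eventually (\<lambda>n. f (s n) = 1) sequentially"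
proof -
  let ?f = "\<lambda>y. max 0 (min 1 (u y - u x))"
  have "(\<lambda>y\<in>topspace X. ?f y) \<in> C_bdd X"
    by (rule restrict_in_C_bdd[where B = 1]) (auto intro!: continuous_intros u)
  moreover obtain N :: nat where N: "u x + 1 - u (s 0) \<le> real N" using real_arch_simple by blast
  have "?f (s n) = 1" if "N \<le> n" for n
  proof -
    have "real N \<le> real n" using that by simp
    then have "1 \<le> u (s n) - u x" using u_lower[of n] N by linarith
    then show ?thesis by simp
  qed
  then have "eventually (\<lambda>n. (\<lambda>y\<in>topspace X. ?f y) (s n) = 1) sequentially"
    unfolding eventually_sequentially using s by (intro exI[of _ N]) simp
  ultimately show ?thesis using assms by (intro bexI[of _ "\<lambda>y\<in>topspace X. ?f y"]) simp_all
qed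

end

section \<open>Isomorphisms between the rings\<close>

text \<open>The inverse isomorphism is a parameter, so that every result can also be read in the
  opposite direction by \<open>flip\<close>.\<close>

locale two_ultrafilters = unbounded_sequence X u s + U: sequence_along_ultrafilter X s U + V: sequence_along_ultrafilter X s V
  for X :: "'a topology" and u s U V +
  fixes \<phi> \<psi> :: "('a \<Rightarrow> real) \<Rightarrow> 'a \<Rightarrow> real"
  assumes U_free: "U \<le> sequentially" and V_free: "V \<le> sequentially"
    and \<phi>: "\<phi> \<in> ring_hom (subring_of_C X (limit_ring X s U)) (subring_of_C X (limit_ring X s V))"
    and \<psi>: "\<psi> \<in> ring_hom (subring_of_C X (limit_ring X s V)) (subring_of_C X (limit_ring X s U))"
    and \<psi>_\<phi>: "\<And>f. f \<in> limit_ring X s U \<Longrightarrow> \<psi> (\<phi> f) = f"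
    and \<phi>_\<psi>: "\<And>f. f \<in> limit_ring X s V \<Longrightarrow> \<phi> (\<psi> f) = f"
begin

lemma \<phi>_closed: "f \<in> limit_ring X s U \<Longrightarrow> \<phi> f \<in> limit_ring X s V"
  using ring_hom_closed[OF \<phi>] by simp

lemma \<psi>_closed: "f \<in> limit_ring X s V \<Longrightarrow> \<psi> f \<in> limit_ring X s U"
  using ring_hom_closed[OF \<psi>] by simp

lemma bdd_U: "C_bdd X \<subseteq> limit_ring X s U"
  using U.intermediate_limit_ring by (simp add: intermediate_ring_def)

lemma bdd_V: "C_bdd X \<subseteq> limit_ring X s V"
  using V.intermediate_limit_ring by (simp add: intermediate_ring_def)

lemma flip: "two_ultrafilters X u s V U \<psi> \<phi>"
  by unfold_locales (use U_free V_free \<phi> \<psi> \<psi>_\<phi> \<phi>_\<psi> in auto)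

text \<open>An evaluation composed with \<open>\<phi>\<close> is a character, and the characters are
  known.\<close>

lemma ex_point:
  assumes z: "z \<in> pts X"
  shows "\<exists>w\<in>pts X. \<forall>f\<in>limit_ring X s U. pt_eval s V z (\<phi> f) = pt_eval s U w f"
proof (rule U.character_eq_pt_eval[OF realcompact])
  have V: "character X (limit_ring X s V) (pt_eval s V z)" using z by (rule V.pt_eval_character)
  show "character X (limit_ring X s U) (\<lambda>f. pt_eval s V z (\<phi> f))"
    unfolding character_def
  proof (intro conjI ballI)
    show "pt_eval s V z (\<phi> (\<lambda>x\<in>topspace X. 1)) = 1"
      using ring_hom_one[OF \<phi>] V by (simp add: C_ring_simps character_def)
    fix f g assume fg: "f \<in> limit_ring X s U" "g \<in> limit_ring X s U"
    then have "\<phi> (\<lambda>x\<in>topspace X. f x + g x) = (\<lambda>x\<in>topspace X. \<phi> f x + \<phi> g x)"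
      "\<phi> (\<lambda>x\<in>topspace X. f x * g x) = (\<lambda>x\<in>topspace X. \<phi> f x * \<phi> g x)"
      using ring_hom_add[OF \<phi>, of f g] ring_hom_mult[OF \<phi>, of f g] by (simp_all add: C_ring_simps)
    then show "pt_eval s V z (\<phi> (\<lambda>x\<in>topspace X. f x + g x)) = pt_eval s V z (\<phi> f) + pt_eval s V z (\<phi> g)"
      "pt_eval s V z (\<phi> (\<lambda>x\<in>topspace X. f x * g x)) = pt_eval s V z (\<phi> f) * pt_eval s V z (\<phi> g)"
      using V \<phi>_closed[OF fg(1)] \<phi>_closed[OF fg(2)] by (simp_all add: character_def)
  qed
qed

text \<open>The ideal point is the only one without a countable base of neighbourhoods, where cozero sets
  serve as neighbourhoods.\<close>

lemma ideal_point_fixed: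
  assumes f: "f \<in> limit_ring X s U"
  shows "pt_eval s V None (\<phi> f) = pt_eval s U None f"
proof -
  obtain w where w: "w \<in> pts X" "\<And>f. f \<in> limit_ring X s U \<Longrightarrow> pt_eval s V None (\<phi> f) = pt_eval s U w f"
    using ex_point[of None] by blast
  have "w = None"
  proof (rule ccontr)
    assume "w \<noteq> None"
    then obtain a where a: "w = Some a" "a \<in> topspace X" using w(1) by auto
    obtain B where "\<forall>k. openin X (B k) \<and> a \<in> B k"
        "\<forall>W. openin X W \<longrightarrow> a \<in> W \<longrightarrow> (\<exists>k::nat. B k \<subseteq> W)"
      using first_countable_base_sequence[OF first_countable a(2)] by blast
    then have B: "openin X (B k)" "a \<in> B k" "openin X W \<Longrightarrow> a \<in> W \<Longrightarrow> \<exists>k. B k \<subseteq> W" for k W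
      by auto
    obtain e where e: "e \<in> C_bdd X" "e a = 0" "eventually (\<lambda>n. e (s n) = 1) sequentially"
      using ex_vanishing_at_point[OF a(2)] by blast
    \<comment> \<open>The bump in \<open>B k\<close> is multiplied by \<open>1 - e\<close>, which is
      1 at \<open>a\<close> and 0 at the ideal point.\<close>
    have "\<exists>h\<in>limit_ring X s U. h a = 1 \<and> pt_eval s U None h = 0 \<and> (\<forall>y\<in>topspace X - B k. h y = 0)" for k
    proof -
      obtain b where b: "continuous_map X euclideanreal b" "\<And>y. y \<in> topspace X \<Longrightarrow> 0 \<le> b y"
          "\<And>y. y \<in> topspace X \<Longrightarrow> b y \<le> 1" "b a = 1" "\<And>y. y \<in> topspace X - B k \<Longrightarrow> b y = 0"
        using Tychonoff_bump[OF Tychonoff B(1,2)] by metis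
      let ?h = "\<lambda>y\<in>topspace X. b y * (1 - e y)"
      have "continuous_map X euclideanreal (\<lambda>y. b y * (1 - e y))"
        using b(1) e(1) by (intro continuous_intros) (auto simp: C_bdd_def C_ring_simps)
      then have "?h \<in> carrier (C_ring X)" by (rule restrict_in_C_ring)
      moreover have "eventually (\<lambda>n. ?h (s n) = 0) U"
        by (rule eventually_mono[OF filter_leD[OF U_free e(3)]]) (simp add: s)
      then have lim: "((\<lambda>n. ?h (s n)) \<longlongrightarrow> 0) U" by (rule tendsto_eventually)
      ultimately have "?h \<in> limit_ring X s U" by (auto simp: limit_ring_def)
      moreover have "pt_eval s U None ?h = 0" using lim by (rule U.pt_eval_None_eqI)
      ultimately show ?thesis
        using a(2) b(4,5) e(2) by (intro bexI[of _ ?h]) simp_all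
    qed
    then obtain h where h: "\<And>k. h k \<in> limit_ring X s U" "\<And>k. h k a = 1"
        "\<And>k. pt_eval s U None (h k) = 0" "\<And>k y. y \<in> topspace X - B k \<Longrightarrow> h k y = 0"
      by metis
    \<comment> \<open>If the ideal point on the \<open>V\<close> side corresponds to
      \<open>a\<close>, then \<open>\<phi> (h k)\<close> tends to \<open>h k a = 1\<close> along
      \<open>V\<close>.\<close>
    have "infinite {n. \<phi> (h k) (s n) \<noteq> 0}" for k
    proof (rule infinite_if_eventually_sequentially[OF V_free V.U_nontrivial])
      have "((\<lambda>n. \<phi> (h k) (s n)) \<longlongrightarrow> 1) V"
        using V.tendsto_pt_eval[OF \<phi>_closed[OF h(1)[of k]]] w(2)[OF h(1)[of k]] h(2) a(1)
        by (simp add: pt_eval_def)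
      then show "eventually (\<lambda>n. \<phi> (h k) (s n) \<noteq> 0) V" by (rule tendsto_imp_eventually_ne) simp
    qed
    then obtain T T' where T: "T \<inter> T' = {}" "\<And>k. T \<inter> {n. \<phi> (h k) (s n) \<noteq> 0} \<noteq> {}"
        "\<And>k. T' \<inter> {n. \<phi> (h k) (s n) \<noteq> 0} \<noteq> {}"
      using disjoint_transversals[of "\<lambda>k. {n. \<phi> (h k) (s n) \<noteq> 0}"] by metis
    have "\<not> (eventually (\<lambda>n. n \<in> T) V \<and> eventually (\<lambda>n. n \<in> T') V)"
    proof
      assume "eventually (\<lambda>n. n \<in> T) V \<and> eventually (\<lambda>n. n \<in> T') V"
      then have "eventually (\<lambda>n. n \<in> T \<and> n \<in> T') V" by (simp add: eventually_conj)
      then have "eventually (\<lambda>n. False) V" using T(1) by (auto elim: eventually_mono)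
      then show False using V.U_nontrivial by (simp add: eventually_False)
    qed
    \<comment> \<open>Disjoint sets cannot both be in \<open>V\<close>, so one transversal is
      \<open>V\<close>-small and still meets every nonvanishing set.\<close>
    then obtain R where R: "\<not> eventually (\<lambda>n. n \<in> R) V" "\<And>k. R \<inter> {n. \<phi> (h k) (s n) \<noteq> 0} \<noteq> {}"
      using T(2,3) by (cases "eventually (\<lambda>n. n \<in> T) V") auto
    then have nR: "eventually (\<lambda>n. n \<notin> R) V" using V.U ultrafilter_not_iff by blast
    \<comment> \<open>\<open>g\<close> is 0 on \<open>R\<close> but tends to 1 along
      \<open>V\<close>, so \<open>\<psi> g\<close> is 1 at \<open>a\<close> and nonzero on some
      \<open>B k\<close>. The transversal supplies \<open>n \<in> R\<close> whose partner lies in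
      \<open>B k\<close>, although \<open>\<psi> g\<close> takes the value
      \<open>g (s n) = 0\<close> at that partner.\<close>
    obtain g where g: "g \<in> C_bdd X" "\<And>n. g (s n) = of_bool (n \<in> - R)"
      using ex_indicator by blast
    have gV: "g \<in> limit_ring X s V" using g(1) bdd_V by blast
    have "eventually (\<lambda>n. g (s n) = 1) V" by (rule eventually_mono[OF nR]) (simp add: g(2))
    then have "pt_eval s V None g = 1" by (intro V.pt_eval_None_eqI tendsto_eventually)
    then have ga: "\<psi> g a = 1"
      using w(2)[OF \<psi>_closed[OF gV]] \<phi>_\<psi>[OF gV] a(1) by (simp add: pt_eval_def)
    have "continuous_map X euclideanreal (\<psi> g)"
      using \<psi>_closed[OF gV] U.limit_ring_subset C_ring_continuous by blast
    then have "openin X {y \<in> topspace X. \<psi> g y \<in> - {0}}"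
      by (rule openin_continuous_map_preimage) (simp add: open_Compl)
    then obtain k where k: "B k \<subseteq> {y \<in> topspace X. \<psi> g y \<in> - {0}}"
      using B(3)[of "{y \<in> topspace X. \<psi> g y \<in> - {0}}"] a(2) ga by auto
    obtain n where n: "n \<in> R" "\<phi> (h k) (s n) \<noteq> 0" using R(2)[of k] by blast
    obtain b where b: "b \<in> pts X" "\<And>f. f \<in> limit_ring X s U \<Longrightarrow> \<phi> f (s n) = pt_eval s U b f"
      using ex_point[of "Some (s n)"] s unfolding pt_eval_Some by blast
    have "pt_eval s U b (h k) \<noteq> 0" using n(2) b(2)[OF h(1)] by simp
    then obtain y where y: "b = Some y" "y \<in> topspace X" "h k y \<noteq> 0"
      using b(1) h(3)[of k] by (cases b) (auto simp: pt_eval_def)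
    then have "\<psi> g y \<noteq> 0" using h(4)[of y k] k by blast
    moreover have "\<psi> g y = g (s n)"
      using b(2)[OF \<psi>_closed[OF gV]] \<phi>_\<psi>[OF gV] y(1) by (simp add: pt_eval_def)
    ultimately show False using g(2)[of n] n(1) by simp
  qed
  then show ?thesis using w(2)[OF f] by simp
qed

text \<open>Ideal points correspond, so an ideal partner of \<open>y\<close> would make every
  function of the ring of \<open>V\<close> take its limit along \<open>V\<close> at
  \<open>y\<close>; the function \<open>e\<close> refutes this.\<close>

lemma ex_real_point:
  assumes y: "y \<in> topspace X"
  shows "\<exists>x\<in>topspace X. \<forall>f\<in>limit_ring X s U. \<phi> f y = f x"
proof -
  obtain w where w: "w \<in> pts X" "\<And>f. f \<in> limit_ring X s U \<Longrightarrow> \<phi> f y = pt_eval s U w f"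
    using ex_point[of "Some y"] y unfolding pt_eval_Some by blast
  have "w \<noteq> None"
  proof
    assume "w = None"
    obtain e where e: "e \<in> C_bdd X" "e y = 0" "eventually (\<lambda>n. e (s n) = 1) sequentially"
      using ex_vanishing_at_point[OF y] by blast
    have eV: "e \<in> limit_ring X s V" using e(1) bdd_V by blast
    have "e y = pt_eval s U None (\<psi> e)"
      using w(2)[OF \<psi>_closed[OF eV]] \<phi>_\<psi>[OF eV] \<open>w = None\<close> by simp
    also have "\<dots> = pt_eval s V None e"
      using ideal_point_fixed[OF \<psi>_closed[OF eV]] \<phi>_\<psi>[OF eV] by simp
    also have "\<dots> = 1"
      using filter_leD[OF V_free e(3)] by (intro V.pt_eval_None_eqI tendsto_eventually)
    finally show False using e(2) by simp
  qed
  then show ?thesis using w by (auto simp: pt_eval_def)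
qed

lemma ultrafilter_eq_filtermap: "\<exists>\<rho>. U = filtermap \<rho> V"
proof -
  interpret flip: two_ultrafilters X u s V U \<psi> \<phi> by (rule flip)
  have "\<forall>y\<in>topspace X. \<exists>x\<in>topspace X. \<forall>f\<in>limit_ring X s U. \<phi> f y = f x"
    using ex_real_point by blast
  then obtain \<sigma> where \<sigma>: "\<And>y. y \<in> topspace X \<Longrightarrow> \<sigma> y \<in> topspace X"
      "\<And>y f. y \<in> topspace X \<Longrightarrow> f \<in> limit_ring X s U \<Longrightarrow> \<phi> f y = f (\<sigma> y)"
    by metis
  \<comment> \<open>With this \<open>g\<close>, the equation \<open>\<phi> g (s n) = 0\<close> says
    that \<open>\<sigma> (s n)\<close> lies on the sequence.\<close>
  obtain g where g: "g \<in> C_bdd X" "\<And>x. x \<in> topspace X \<Longrightarrow> g x = 0 \<longleftrightarrow> x \<in> range s"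
    using ex_zero_set[of UNIV] by blast
  have gU: "g \<in> limit_ring X s U" using g(1) bdd_U by blast
  have "eventually (\<lambda>n. \<phi> g (s n) = 0) V"
  proof (rule ccontr)
    assume no: "\<not> ?thesis"
    define D where "D = {n. \<phi> g (s n) \<noteq> 0}"
    have D: "eventually (\<lambda>n. n \<in> D) V"
      using no V.U ultrafilter_not_iff[of V "\<lambda>n. \<phi> g (s n) = 0"] by (simp add: D_def)
    obtain t where t: "t \<in> C_bdd X" "\<And>x. x \<in> topspace X \<Longrightarrow> 0 \<le> t x"
        "\<And>x. x \<in> topspace X \<Longrightarrow> t x = 0 \<longleftrightarrow> x \<in> s ` D"
      using ex_zero_set[of D] by blast
    have cont: "continuous_map X euclideanreal t" "continuous_map X euclideanreal (\<phi> g)"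
      using t(1) \<phi>_closed[OF gU] V.limit_ring_subset C_ring_continuous by (auto simp: C_bdd_def)
    text \<open>\<open>w\<close> separates the disjoint zero sets of \<open>t\<close> and \<open>\<phi> g\<close>.\<close>
    have pos: "0 < t x + \<bar>\<phi> g x\<bar>" if "x \<in> topspace X" for x
    proof (cases "t x = 0")
      case True
      then have "x \<in> s ` D" using t(3)[OF that] by blast
      then show ?thesis using True by (auto simp: D_def)
    next
      case False
      then show ?thesis using t(2)[OF that] by simp
    qed
    let ?w = "\<lambda>x. t x / (t x + \<bar>\<phi> g x\<bar>)"
    define w where "w = (\<lambda>x\<in>topspace X. ?w x)"
    have "w \<in> C_bdd X"
      unfolding w_def
    proof (rule restrict_in_C_bdd[where B = 1])
      show "continuous_map X euclideanreal ?w"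
        using cont pos by (intro continuous_intros) force+
      show "\<bar>?w x\<bar> \<le> 1" if "x \<in> topspace X" for x
        using pos[OF that] t(2)[OF that] by (simp add: abs_le_iff divide_le_eq_1)
    qed
    then have wV: "w \<in> limit_ring X s V" using bdd_V by blast
    have "\<psi> w (s n) = 1" for n
    proof -
      obtain x where x: "x \<in> topspace X" "\<And>f. f \<in> limit_ring X s V \<Longrightarrow> \<psi> f (s n) = f x"
        using flip.ex_real_point[OF s[of n]] by blast
      have "\<phi> g x = g (s n)" using x(2)[OF \<phi>_closed[OF gU]] \<psi>_\<phi>[OF gU] by simp
      then have "\<phi> g x = 0" using g(2)[OF s[of n]] by simp
      then show ?thesis using x(2)[OF wV] pos[OF x(1)] x(1) by (simp add: w_def)
    qed
    then have "pt_eval s U None (\<psi> w) = 1" by (intro U.pt_eval_None_eqI) simp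
    moreover have "eventually (\<lambda>n. w (s n) = 0) V"
    proof (rule eventually_mono[OF D])
      fix n assume "n \<in> D"
      then have "t (s n) = 0" using t(3)[OF s] by blast
      then show "w (s n) = 0" by (simp add: w_def s)
    qed
    then have "pt_eval s V None w = 0" by (intro V.pt_eval_None_eqI tendsto_eventually)
    ultimately show False using flip.ideal_point_fixed[OF wV] by simp
  qed
  then have hit: "eventually (\<lambda>n. \<sigma> (s n) \<in> range s) V"
    by (rule eventually_mono) (use \<sigma> s gU g(2) in metis)
  \<comment> \<open>The value of \<open>\<rho>\<close> is arbitrary outside the
    \<open>V\<close>-large set given by \<open>hit\<close>.\<close>
  define \<rho> where "\<rho> n = (SOME m. \<sigma> (s n) = s m)" for n
  have \<rho>: "\<sigma> (s n) = s (\<rho> n)" if "\<sigma> (s n) \<in> range s" for n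
  proof -
    have "\<exists>m. \<sigma> (s n) = s m" using that by blast
    then show ?thesis unfolding \<rho>_def by (rule someI_ex)
  qed
  \<comment> \<open>One inequality suffices, by minimality of the ultrafilter
    \<open>U\<close>.\<close>
  have "filtermap \<rho> V \<le> U"
  proof (rule filter_leI)
    fix P assume P: "eventually P U"
    obtain f where f: "f \<in> C_bdd X" "\<And>n. f (s n) = of_bool (n \<in> {n. P n})"
      using ex_indicator by blast
    have fU: "f \<in> limit_ring X s U" using f(1) bdd_U by blast
    have "eventually (\<lambda>n. f (s n) = 1) U" by (rule eventually_mono[OF P]) (simp add: f(2))
    then have "pt_eval s U None f = 1" by (intro U.pt_eval_None_eqI tendsto_eventually)
    then have "((\<lambda>n. \<phi> f (s n)) \<longlongrightarrow> 1) V"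
      using V.tendsto_pt_eval[OF \<phi>_closed[OF fU]] ideal_point_fixed[OF fU] by simp
    then have "eventually (\<lambda>n. \<phi> f (s n) \<noteq> 0) V" by (rule tendsto_imp_eventually_ne) simp
    with hit have "eventually (\<lambda>n. P (\<rho> n)) V"
    proof eventually_elim
      case (elim n)
      have "\<phi> f (s n) = f (s (\<rho> n))" using \<sigma>(2)[OF s fU] \<rho>[OF elim(1)] by simp
      then show ?case using elim(2) f(2)[of "\<rho> n"] by auto
    qed
    then show "eventually P (filtermap \<rho> V)" by (simp add: eventually_filtermap)
  qed
  then have "filtermap \<rho> V = U"
    using U.U V.U_nontrivial by (intro ultrafilter_le_imp_eq) (simp_all add: filtermap_bot_iff)
  then show ?thesis by blast
qed

end

section \<open>Counting the isomorphism classes\<close>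

lemma (in unbounded_sequence) isomorphic_limit_rings:
  assumes "ultrafilter U" "ultrafilter V" "U \<le> sequentially" "V \<le> sequentially"
    and "subring_of_C X (limit_ring X s U) \<simeq> subring_of_C X (limit_ring X s V)"
  shows "\<exists>\<rho>. U = filtermap \<rho> V"
proof -
  interpret U: sequence_along_ultrafilter X s U by unfold_locales (use s assms in auto)
  interpret V: sequence_along_ultrafilter X s V by unfold_locales (use s assms in auto)
  interpret C: cring "C_ring X" by (rule cring_C_ring)
  have rings: "ring (subring_of_C X (limit_ring X s U))"
    using U.intermediate_limit_ring C.subring_is_ring unfolding intermediate_ring_def by blast
  obtain \<phi> where \<phi>: "\<phi> \<in> ring_iso (subring_of_C X (limit_ring X s U)) (subring_of_C X (limit_ring X s V))"
    using assms(5) unfolding is_ring_iso_def by blast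
  let ?\<psi> = "inv_into (limit_ring X s U) \<phi>"
  have \<psi>: "?\<psi> \<in> ring_iso (subring_of_C X (limit_ring X s V)) (subring_of_C X (limit_ring X s U))"
    using ring_iso_set_sym[OF rings \<phi>] by simp
  have bij: "bij_betw \<phi> (limit_ring X s U) (limit_ring X s V)"
    using ring_iso_memE(5)[OF \<phi>] by simp
  interpret two_ultrafilters X u s U V \<phi> ?\<psi>
  proof unfold_locales
    show "\<phi> \<in> ring_hom (subring_of_C X (limit_ring X s U)) (subring_of_C X (limit_ring X s V))"
      "?\<psi> \<in> ring_hom (subring_of_C X (limit_ring X s V)) (subring_of_C X (limit_ring X s U))"
      using \<phi> \<psi> by (simp_all add: ring_iso_def)
  qed (use assms bij in \<open>auto simp: bij_betw_inv_into_left bij_betw_inv_into_right\<close>)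
  show ?thesis by (rule ultrafilter_eq_filtermap)
qed

text \<open>With \<open>u = \<bar>f\<bar>\<close> for an unbounded \<open>f\<close>, each next point
  is chosen with value at least 2 higher.\<close>

lemma ex_unbounded_sequence:
  assumes "Tychonoff_space X" "first_countable X" "realcompact_space X" "\<not> pseudocompact_space X"
  shows "\<exists>u s. unbounded_sequence X u s"
proof -
  obtain f where f: "f \<in> carrier (C_ring X)" "\<not> bounded (f ` topspace X)"
    using assms(4) unfolding pseudocompact_space_def C_bdd_def by blast
  define u where "u x = \<bar>f x\<bar>" for x
  have large: "\<exists>x\<in>topspace X. M \<le> u x" for M
  proof (rule ccontr)
    assume "\<not> ?thesis"
    then have "bounded (f ` topspace X)" by (intro boundedI[of _ M]) (force simp: u_def)
    then show False using f(2) by simp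
  qed
  have "\<exists>s. \<forall>n. s n \<in> topspace X \<and> u (s n) + 2 \<le> u (s (Suc n))"
    by (rule dependent_nat_choice) (use large in blast)+
  then obtain s where s: "\<And>n. s n \<in> topspace X" "\<And>n. u (s n) + 2 \<le> u (s (Suc n))" by blast
  have "continuous_map X euclideanreal u"
    unfolding u_def using C_ring_continuous[OF f(1)] by (intro continuous_intros)
  then show ?thesis using assms s unfolding unbounded_sequence_def by blast
qed

theorem theorem2p12:
  fixes X :: "'a topology"
  assumes "Tychonoff_space X"
    and "first_countable X"
    and "realcompact_space X"
    and "\<not> pseudocompact_space X"
  shows "\<exists>\<F> :: ('a \<Rightarrow> real) set set.
           Pow (Pow (UNIV :: nat set)) \<lesssim> \<F> \<and>
           (\<forall>A\<in>\<F>. intermediate_ring X A \<and> C_type X A) \<and>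
           (\<forall>A\<in>\<F>. \<forall>B\<in>\<F>. A \<noteq> B \<longrightarrow> \<not> subring_of_C X A \<simeq> subring_of_C X B)"
proof -
  obtain u s where "unbounded_sequence X u s"
    using ex_unbounded_sequence[OF assms] by blast
  then interpret unbounded_sequence X u s .
  interpret C: cring "C_ring X" by (rule cring_C_ring)
  obtain g :: "nat set set \<Rightarrow> nat filter"
    where g: "inj g" "\<And>\<A>. ultrafilter (g \<A>)" "\<And>\<A>. g \<A> \<le> sequentially"
    using ex_free_ultrafilters by blast
  define A where "A \<A> = limit_ring X s (g \<A>)" for \<A>
  have seq: "sequence_along_ultrafilter X s (g \<A>)" for \<A>
    by unfold_locales (use s g in auto)
  have A: "intermediate_ring X (A \<A>)" "C_type X (A \<A>)" for \<A>
    unfolding A_def using sequence_along_ultrafilter.intermediate_limit_ring[OF seq]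
      sequence_along_ultrafilter.C_type_limit_ring[OF seq] by auto
  define R where "R \<A> \<B> \<longleftrightarrow> subring_of_C X (A \<A>) \<simeq> subring_of_C X (A \<B>)" for \<A> \<B>
  have ring: "ring (subring_of_C X (A \<A>))" for \<A>
    using A(1) C.subring_is_ring unfolding intermediate_ring_def by blast
  have "equivp R"
  proof (rule equivpI)
    show "reflp R" unfolding R_def by (rule reflpI) (rule ring_iso_refl)
    show "symp R" unfolding R_def by (rule sympI) (rule ring_iso_sym[OF ring])
    show "transp R" unfolding R_def by (rule transpI) (rule ring_iso_trans)
  qed
  \<comment> \<open>For fixed \<open>\<A>\<close>, the map \<open>\<rho> \<B>\<close> determines the
    ultrafilter \<open>g \<B>\<close> and hence, \<open>g\<close> being injective,
    \<open>\<B>\<close> itself.\<close>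
  moreover have "{\<B>. R \<A> \<B>} \<lesssim> (UNIV :: (nat \<Rightarrow> nat) set)" for \<A>
  proof -
    have "\<forall>\<B>. \<exists>\<rho>. R \<A> \<B> \<longrightarrow> g \<B> = filtermap \<rho> (g \<A>)"
      using isomorphic_limit_rings[OF g(2) g(2) g(3) g(3)] ring_iso_sym[OF ring]
      unfolding R_def A_def by blast
    then obtain \<rho> where \<rho>: "\<And>\<B>. R \<A> \<B> \<Longrightarrow> g \<B> = filtermap (\<rho> \<B>) (g \<A>)" by metis
    have "inj_on \<rho> {\<B>. R \<A> \<B>}"
      by (rule inj_onI) (metis \<rho> g(1) injD mem_Collect_eq)
    then show ?thesis unfolding lepoll_def by blast
  qed
  ultimately have "\<exists>T. Pow (Pow (UNIV :: nat set)) \<lesssim> T \<and> (\<forall>\<A>\<in>T. \<forall>\<B>\<in>T. R \<A> \<B> \<longrightarrow> \<A> = \<B>)"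
    by (rule ex_large_set_of_representatives)
  then obtain T where T: "Pow (Pow (UNIV :: nat set)) \<lesssim> T"
      "\<forall>\<A>\<in>T. \<forall>\<B>\<in>T. R \<A> \<B> \<longrightarrow> \<A> = \<B>"
    by (elim exE conjE)
  \<comment> \<open>Equal rings are isomorphic, so the chosen representatives yield distinct rings
    and no cardinality is lost.\<close>
  have "inj_on A T"
  proof (rule inj_onI)
    fix \<A> \<B> assume "\<A> \<in> T" "\<B> \<in> T" "A \<A> = A \<B>"
    then show "\<A> = \<B>" using T(2) ring_iso_refl[of "subring_of_C X (A \<A>)"] by (simp add: R_def)
  qed
  then have "T \<lesssim> A ` T" unfolding lepoll_def by blast
  with T(1) have "Pow (Pow (UNIV :: nat set)) \<lesssim> A ` T" by (rule lepoll_trans)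
  moreover have "\<not> subring_of_C X B \<simeq> subring_of_C X B'" if B: "B \<in> A ` T" "B' \<in> A ` T" "B \<noteq> B'" for B B'
  proof
    assume iso: "subring_of_C X B \<simeq> subring_of_C X B'"
    obtain \<A> \<B> where "\<A> \<in> T" "\<B> \<in> T" "B = A \<A>" "B' = A \<B>" using B(1,2) by blast
    then show False using T(2) iso B(3) by (auto simp: R_def)
  qed
  ultimately show ?thesis using A by (intro exI[of _ "A ` T"]) blast
qed

end
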